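(* Let $b>1$ be an integer and let $H$ be a generalized $b$-happy function with digit mean $\mu$ and digit standard deviation $\sigma$. Let $C\subseteq\mathbb{N}$. Suppose $n_1$ is a positive integer satisfying bound (B), i.e. (B1) $4\left(1+3\mu+\sqrt{2}\,\sigma\, b^{5n_1/8}\right)\le b^{n_1-1}$, (B2) $\sqrt{3\mu b}\,\sigma\le b^{3n_1/8}$, (B3) $4\mu\left(3\mu+1+b^{3n_1/4}+2\sigma\mu^{-1/2}b^{5n_1/8}\right)\le b^{n_1-1}$, and suppose $I_1$ is an $n_1$-strict integer interval whose type-$C$ density equals $d_1$. Then the upper density of the set of type-$C$ integers satisfies $$\limsup_{N\to\infty}\frac{|\{i\in\mathbb{Z},\ 1\le i\le N:\ i \text{ is type-}C\}|}{N}\;\ge\; d_1\exp\!\left(-\frac{2}{b^{n_1/4}-1}-\frac{4\sigma}{\sqrt{\mu}\,\left(b^{n_1/8}-1\right)}\right).$$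
   Context: A generalized $b$-happy function: fix an integer $b>1$ and non-negative integers $h(0),h(1),\dots,h(b-1)$ with $h(0)=0$, $h(1)=1$. For a non-negative integer $n$ with base-$b$ expansion $n=\sum_{i=0}^k a_ib^i$ ($0\le a_i\le b-1$), set $H(n)=\sum_{i=0}^k h(a_i)$. The digit mean and digit variance of $H$ are the mean and variance of $h(X)$ for $X$ uniform on $\{0,1,\dots,b-1\}$: $\mu=\frac1b\sum_{j=0}^{b-1}h(j)$, $\sigma^2=\frac1b\sum_{j=0}^{b-1}(h(j)-\mu)^2$ (with $\sigma\ge 0$). For $C\subseteq\mathbb{N}$, an integer $n$ is type-$C$ if $H^k(n)\in C$ for some integer $k\ge 0$ ($H^k$ the $k$-th iterate). An integer interval $[a,c]$ ($a,c$ real) is the set of integers $x$ with $a\le x\le c$, and $|I|$ denotes its cardinality. The type-$C$ density of a finite nonempty integer interval $I$ is $|\{n\in I: n\text{ type-}C\}|/|I|$. For a positive integer $n$, an integer interval $I$ is $n$-strict if $I\subseteq[b^{n-1},b^n-1]$ and $|I|=b^{3n/4}$. *)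

theory Defs
  imports Complex_Main "HOL-Library.Extended_Real" "HOL-Library.Liminf_Limsup"
begin

function happyH :: "nat \<Rightarrow> (nat \<Rightarrow> nat) \<Rightarrow> nat \<Rightarrow> nat" where
  "happyH b h n = (if n = 0 \<or> b \<le> 1 then 0 else h (n mod b) + happyH b h (n div b))"
  by auto
termination
  by (relation "measure (\<lambda>(b, h, n). n)") auto

definition digit_mean :: "nat \<Rightarrow> (nat \<Rightarrow> nat) \<Rightarrow> real" where
  "digit_mean b h = (\<Sum>j<b. real (h j)) / real b"

definition digit_sd :: "nat \<Rightarrow> (nat \<Rightarrow> nat) \<Rightarrow> real" where
  "digit_sd b h = sqrt ((\<Sum>j<b. (real (h j) - digit_mean b h)^2) / real b)"

definition typeC :: "nat \<Rightarrow> (nat \<Rightarrow> nat) \<Rightarrow> nat set \<Rightarrow> nat \<Rightarrow> bool" where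
  "typeC b h C n \<longleftrightarrow> (\<exists>k. (happyH b h ^^ k) n \<in> C)"

definition int_interval :: "real \<Rightarrow> real \<Rightarrow> nat set" where
  "int_interval a c = {x. a \<le> real x \<and> real x \<le> c}"

definition typeC_density :: "nat \<Rightarrow> (nat \<Rightarrow> nat) \<Rightarrow> nat set \<Rightarrow> nat set \<Rightarrow> real" where
  "typeC_density b h C I = real (card {n\<in>I. typeC b h C n}) / real (card I)"

definition strict_interval :: "nat \<Rightarrow> nat \<Rightarrow> nat set \<Rightarrow> bool" where
  "strict_interval b n I \<longleftrightarrow> (\<exists>a c. I = int_interval a c) \<and>
     I \<subseteq> {b^(n-1) .. b^n - 1} \<and> real (card I) = real b powr (3 * real n / 4)"

end

theory Submission
  imports Defs
begin

text \<open>
  Let \<open>z = b powr (n / 8)\<close>. The digit sum \<open>H\<close> of \<open>m\<close> uniformly random digits has mean \<open>m \<mu>\<close> and variance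
  \<open>m \<sigma>\<^sup>2\<close>; when \<open>m \<mu>\<close> is of the order of the elements of an \<open>n\<close>-strict interval \<open>I\<close>, its standard deviation
  is much smaller than \<open>|I| = z ^ 6\<close>. Hence if \<open>k\<close> runs through slightly more than \<open>|I|\<close> consecutive values,
  \<open>k + H\<close> is almost equidistributed on \<open>I\<close>, so for some \<open>k\<close> it hits the type-\<open>C\<close> part of \<open>I\<close> with probability
  almost the density \<open>d\<close> of \<open>I\<close>. Putting the prefix \<open>1...10...0\<close> with \<open>k\<close> ones in front of the random digits
  realises \<open>k + H\<close> on an \<open>n'\<close>-strict interval with \<open>n' \<ge> 2 n\<close>, and \<open>d\<close> drops at most by the
  factor \<open>exp (- 2 / z\<^sup>2 - 4 \<sigma> / (sqrt \<mu> z))\<close>. These losses telescope to the exponent of the theorem.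

  Strict intervals are too short to bear on the upper density. To pass to all numbers below \<open>b ^ M\<close>, the
  shift \<open>k\<close> is replaced by extra random digits: appending \<open>b t\<close> of them shifts \<open>H\<close> by
  \<open>b \<mu> t + O(sqrt t)\<close>. The law of \<open>H\<close> for \<open>m\<close> digits moves by \<open>O(1 / sqrt m)\<close> in total variation under
  a unit shift, so both the fluctuation \<open>O(sqrt t)\<close> and the gaps \<open>b \<mu>\<close> between these shifts are harmless.
\<close>

section \<open>Averages over digit words\<close>

declare happyH.simps [simp del]

text \<open>Expectation of \<open>F\<close> over \<open>M\<close> independent uniform digits.
  Recursion on the word takes the place of a probability space: linearity, monotonicity and moments
  become inductions on \<open>M\<close>.\<close>

fun wmean :: "nat \<Rightarrow> nat \<Rightarrow> (nat list \<Rightarrow> real) \<Rightarrow> real" where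
  "wmean b 0 F = F []"
| "wmean b (Suc M) F = (\<Sum>d<b. wmean b M (\<lambda>xs. F (d # xs))) / real b"

lemma wmean_add: "wmean b M (\<lambda>xs. F xs + G xs) = wmean b M F + wmean b M G"
  by (induction M arbitrary: F G) (simp_all add: sum.distrib add_divide_distrib)

lemma wmean_cmult: "wmean b M (\<lambda>xs. c * F xs) = c * wmean b M F"
  by (induction M arbitrary: F) (simp_all add: sum_distrib_left)

lemma wmean_diff: "wmean b M (\<lambda>xs. F xs - G xs) = wmean b M F - wmean b M G"
  using wmean_add[of b M F "\<lambda>xs. (-1) * G xs"] wmean_cmult[of b M "-1" G] by simp

lemma wmean_sum: "wmean b M (\<lambda>xs. \<Sum>i\<in>A. F i xs) = (\<Sum>i\<in>A. wmean b M (F i))"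
proof (induction A rule: infinite_finite_induct)
  case (insert x A)
  then show ?case by (simp add: wmean_add)
qed (use wmean_cmult[of b M 0] in simp_all)

lemma wmean_const: "b > 0 \<Longrightarrow> wmean b M (\<lambda>xs. c) = c"
  by (induction M) simp_all

lemma wmean_mono: "(\<And>xs. F xs \<le> G xs) \<Longrightarrow> wmean b M F \<le> wmean b M G"
proof (induction M arbitrary: F G)
  case (Suc M)
  then show ?case by (auto intro!: divide_right_mono sum_mono)
qed simp

lemma wmean_abs: "\<bar>wmean b M F\<bar> \<le> wmean b M (\<lambda>xs. \<bar>F xs\<bar>)"
proof -
  have "wmean b M F \<le> wmean b M (\<lambda>xs. \<bar>F xs\<bar>)"
    by (intro wmean_mono) simp
  moreover have "wmean b M (\<lambda>xs. (-1) * F xs) \<le> wmean b M (\<lambda>xs. \<bar>F xs\<bar>)"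
    by (intro wmean_mono) simp
  ultimately show ?thesis by (simp only: wmean_cmult abs_le_iff) simp
qed

lemma wmean_append:
  "wmean b (r + M) F = wmean b r (\<lambda>xs. wmean b M (\<lambda>ys. F (xs @ ys)))"
  by (induction r arbitrary: F) simp_all

text \<open>Nonnegativity of the variance of the absolute value of \<open>F\<close>.\<close>

lemma wmean_abs_le_sqrt:
  assumes "b > 0"
  shows "wmean b M (\<lambda>xs. \<bar>F xs\<bar>) \<le> sqrt (wmean b M (\<lambda>xs. (F xs)\<^sup>2))"
proof -
  let ?m = "wmean b M (\<lambda>xs. \<bar>F xs\<bar>)"
  have "0 \<le> wmean b M (\<lambda>xs. (\<bar>F xs\<bar> - ?m)\<^sup>2)"
    using wmean_mono[of "\<lambda>_. 0" "\<lambda>xs. (\<bar>F xs\<bar> - ?m)\<^sup>2" b M] wmean_const[OF assms, of M 0] by simp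
  also have "(\<lambda>xs. (\<bar>F xs\<bar> - ?m)\<^sup>2) = (\<lambda>xs. (F xs)\<^sup>2 + (?m\<^sup>2 - (2 * ?m) * \<bar>F xs\<bar>))"
    by (rule ext) (simp add: power2_diff)
  also have "wmean b M \<dots> = wmean b M (\<lambda>xs. (F xs)\<^sup>2) - ?m\<^sup>2"
    by (simp only: wmean_add wmean_diff wmean_cmult wmean_const[OF assms])
      (simp add: power2_eq_square)
  finally show ?thesis by (intro real_le_rsqrt) simp
qed

lemma wmean_sum_list:
  assumes "b > 0"
  shows "wmean b M (\<lambda>xs. \<Sum>x\<leftarrow>xs. g x) = real M * ((\<Sum>j<b. g j) / real b)"
proof (induction M)
  case (Suc M)
  then show ?case using assms
    by (simp add: wmean_add wmean_const sum.distrib field_simps)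
qed simp

text \<open>The cross term between the first digit and the others vanishes because \<open>g\<close>
  is centred, so the variances of the digits add up.\<close>

lemma wmean_sum_list_square:
  assumes "b > 0" and centred: "(\<Sum>j<b. g j) = 0"
  shows "wmean b M (\<lambda>xs. (\<Sum>x\<leftarrow>xs. g x)\<^sup>2) = real M * ((\<Sum>j<b. (g j)\<^sup>2) / real b)"
proof (induction M)
  case (Suc M)
  have "wmean b M (\<lambda>xs. (\<Sum>x\<leftarrow>d # xs. g x)\<^sup>2) = (g d)\<^sup>2 + wmean b M (\<lambda>xs. (\<Sum>x\<leftarrow>xs. g x)\<^sup>2)" for d
  proof -
    have "(\<lambda>xs. (\<Sum>x\<leftarrow>d # xs. g x)\<^sup>2) =
        (\<lambda>xs. (g d)\<^sup>2 + ((2 * g d) * (\<Sum>x\<leftarrow>xs. g x) + (\<Sum>x\<leftarrow>xs. g x)\<^sup>2))"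
      by (rule ext) (simp add: power2_sum)
    then show ?thesis
      by (simp only: wmean_add wmean_cmult wmean_const[OF assms(1)] wmean_sum_list[OF assms(1)] centred
          div_0 mult_zero_right add_0)
  qed
  note cons = this
  show ?case using assms(1)
    by (simp only: wmean.simps cons Suc sum.distrib) (simp add: field_simps)
qed simp

lemma sum_list_centred:
  "(\<Sum>x\<leftarrow>xs. (g x - c :: real)) = (\<Sum>x\<leftarrow>xs. g x) - real (length xs) * c"
  by (induction xs) (simp_all add: algebra_simps)

lemma wmean_cong:
  "(\<And>xs. length xs = M \<Longrightarrow> F xs = G xs) \<Longrightarrow> wmean b M F = wmean b M G"
proof (induction M arbitrary: F G)
  case (Suc M)
  have "wmean b M (\<lambda>xs. F (d # xs)) = wmean b M (\<lambda>xs. G (d # xs))" for d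
    by (rule Suc.IH) (simp add: Suc.prems)
  then show ?case by simp
qed simp

lemma wmean_variance:
  fixes g :: "nat \<Rightarrow> real"
  assumes "b > 0"
  defines "m \<equiv> (\<Sum>j<b. g j) / real b"
  shows "wmean b M (\<lambda>xs. ((\<Sum>x\<leftarrow>xs. g x) - real M * m)\<^sup>2) =
    real M * ((\<Sum>j<b. (g j - m)\<^sup>2) / real b)"
proof -
  have "wmean b M (\<lambda>xs. ((\<Sum>x\<leftarrow>xs. g x) - real M * m)\<^sup>2) =
      wmean b M (\<lambda>xs. (\<Sum>x\<leftarrow>xs. g x - m)\<^sup>2)"
    by (intro wmean_cong) (simp add: sum_list_centred)
  also have "\<dots> = real M * ((\<Sum>j<b. (g j - m)\<^sup>2) / real b)"
    using assms by (intro wmean_sum_list_square) (simp_all add: sum_subtractf)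
  finally show ?thesis .
qed

section \<open>Digit counts, and the effect of a shift on the law of the digit sum\<close>

definition digit_count :: "nat \<Rightarrow> nat list \<Rightarrow> real" where
  "digit_count j xs = (\<Sum>x\<leftarrow>xs. of_bool (x = j))"

text \<open>The count is binomial with success probability \<open>1 / b\<close>, so its variance is
  at most \<open>M / b\<close>.\<close>

lemma wmean_digit_count_deviation:
  assumes "j < b"
  shows "wmean b M (\<lambda>xs. \<bar>digit_count j xs - real M / real b\<bar>) \<le> sqrt (real M / real b)"
proof -
  have b: "b > 0" using assms by simp
  have s: "(\<Sum>i<b. of_bool (i = j) :: real) = 1"
    using assms by (simp add: of_bool_def)
  have "(\<Sum>i<b. (of_bool (i = j) - 1 / real b)\<^sup>2) =
      (\<Sum>i<b. of_bool (i = j) * (1 - 2 / real b) + 1 / (real b)\<^sup>2)"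
    by (intro sum.cong) (auto simp: power2_diff power_divide)
  also have "\<dots> = 1 - 2 / real b + real b / (real b)\<^sup>2"
    using s by (simp add: sum.distrib flip: sum_distrib_right)
  also have "\<dots> \<le> 1" using b by (simp add: power2_eq_square)
  finally have v: "(\<Sum>i<b. (of_bool (i = j) - 1 / real b)\<^sup>2) \<le> 1" .
  have "wmean b M (\<lambda>xs. (digit_count j xs - real M / real b)\<^sup>2) =
      real M * ((\<Sum>i<b. (of_bool (i = j) - 1 / real b)\<^sup>2) / real b)"
    using wmean_variance[OF b, of M "\<lambda>x. of_bool (x = j)"] s by (simp add: digit_count_def)
  also have "\<dots> \<le> real M * (1 / real b)"
    using v by (intro mult_left_mono divide_right_mono) auto
  finally have "sqrt (wmean b M (\<lambda>xs. (digit_count j xs - real M / real b)\<^sup>2)) \<le> sqrt (real M / real b)"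
    by (intro real_sqrt_le_mono) simp
  with wmean_abs_le_sqrt[OF b] show ?thesis by (rule order_trans)
qed

text \<open>Turning a digit 0 into a digit 1 pairs the words with a marked 0 with those with a marked 1.\<close>

lemma wmean_flip_digit:
  assumes "b > 1" "h 0 = (0::nat)" "h 1 = 1"
  shows "wmean b M (\<lambda>xs. digit_count 0 xs * f (sum_list (map h xs) + 1)) =
    wmean b M (\<lambda>xs. digit_count 1 xs * f (sum_list (map h xs)))"
proof (induction M arbitrary: f)
  case 0
  then show ?case by (simp add: digit_count_def)
next
  case (Suc M)
  let ?S = "\<lambda>xs. sum_list (map h xs)"
  have cons: "digit_count j (d # xs) = of_bool (d = j) + digit_count j xs" for j d xs
    by (simp add: digit_count_def)
  \<comment> \<open>The marked digit is either the first one or a later one. A later one is handled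
    by the induction hypothesis for \<open>f\<close> translated by \<open>h d\<close>. A marked
    first digit yields the same term for a 0 as for a 1, and each of these two digits occurs once in
    the sum over \<open>d\<close>.\<close>
  have L: "wmean b M (\<lambda>xs. digit_count 0 (d # xs) * f (?S (d # xs) + 1)) =
      of_bool (d = 0) * wmean b M (\<lambda>xs. f (?S xs + 1)) +
      wmean b M (\<lambda>xs. digit_count 1 xs * f (h d + ?S xs))" for d
  proof -
    have "(\<lambda>xs. digit_count 0 (d # xs) * f (?S (d # xs) + 1)) =
       (\<lambda>xs. of_bool (d = 0) * f (?S xs + 1) + digit_count 0 xs * f (h d + (?S xs + 1)))"
      using assms by (auto simp: cons algebra_simps)
    then show ?thesis
      using Suc.IH[of "\<lambda>s. f (h d + s)"] by (simp only: wmean_add wmean_cmult)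
  qed
  have R: "wmean b M (\<lambda>xs. digit_count 1 (d # xs) * f (?S (d # xs))) =
      of_bool (d = 1) * wmean b M (\<lambda>xs. f (?S xs + 1)) +
      wmean b M (\<lambda>xs. digit_count 1 xs * f (h d + ?S xs))" for d
  proof -
    have "(\<lambda>xs. digit_count 1 (d # xs) * f (?S (d # xs))) =
       (\<lambda>xs. of_bool (d = 1) * f (?S xs + 1) + digit_count 1 xs * f (h d + ?S xs))"
      using assms by (auto simp: cons algebra_simps)
    then show ?thesis by (simp only: wmean_add wmean_cmult)
  qed
  have one: "(\<Sum>d<b. of_bool (d = j) * c) = (c::real)" if "j < b" for j c
    using that by (simp add: of_bool_def flip: sum_distrib_right)
  show ?case
    using assms by (simp only: wmean.simps L R sum.distrib) (simp add: one)
qed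

text \<open>The numbers of zeros and of ones both concentrate at \<open>M / b\<close>, so that the weights in the
  previous identity are almost constant.\<close>

lemma wmean_shift_one:
  assumes "b > 1" "h 0 = (0::nat)" "h 1 = 1" "M > 0" and f: "\<And>s. 0 \<le> f s" "\<And>s. f s \<le> 1"
  shows "\<bar>wmean b M (\<lambda>xs. f (sum_list (map h xs) + 1)) - wmean b M (\<lambda>xs. f (sum_list (map h xs)))\<bar>
    \<le> 2 * sqrt (real b / real M)"
proof -
  let ?S = "\<lambda>xs. sum_list (map h xs)" and ?p = "real M / real b"
  have dev: "\<bar>wmean b M (\<lambda>xs. (digit_count j xs - ?p) * f (g xs))\<bar> \<le> sqrt ?p" if "j < b" for j g
  proof -
    have "\<bar>wmean b M (\<lambda>xs. (digit_count j xs - ?p) * f (g xs))\<bar> \<le>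
        wmean b M (\<lambda>xs. \<bar>(digit_count j xs - ?p) * f (g xs)\<bar>)" by (rule wmean_abs)
    also have "\<dots> \<le> wmean b M (\<lambda>xs. \<bar>digit_count j xs - ?p\<bar>)"
      using f by (intro wmean_mono) (simp add: abs_mult mult_left_le)
    also have "\<dots> \<le> sqrt ?p" using that by (rule wmean_digit_count_deviation)
    finally show ?thesis .
  qed
  have split: "?p * wmean b M (\<lambda>xs. f (g xs)) = wmean b M (\<lambda>xs. digit_count j xs * f (g xs)) -
      wmean b M (\<lambda>xs. (digit_count j xs - ?p) * f (g xs))" for j g
    by (simp only: left_diff_distrib wmean_diff wmean_cmult)
  let ?D = "wmean b M (\<lambda>xs. f (?S xs + 1)) - wmean b M (\<lambda>xs. f (?S xs))"
  have "?p * ?D = wmean b M (\<lambda>xs. (digit_count 1 xs - ?p) * f (?S xs)) -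
      wmean b M (\<lambda>xs. (digit_count 0 xs - ?p) * f (?S xs + 1))"
    using split[of "\<lambda>xs. ?S xs + 1" 0] split[of ?S 1] wmean_flip_digit[of b h M f] assms
    by (simp add: right_diff_distrib)
  then have "\<bar>?p * ?D\<bar> \<le> sqrt ?p + sqrt ?p"
    using dev[OF assms(1), of ?S] dev[OF order.strict_trans[OF zero_less_one assms(1)], of "\<lambda>xs. ?S xs + 1"]
    by (simp only:) (rule order_trans[OF abs_triangle_ineq4 add_mono])
  then have "?p * \<bar>?D\<bar> \<le> 2 * sqrt ?p"
    by (simp only: abs_mult) simp
  also have "\<dots> = ?p * (2 * sqrt (real b / real M))"
    using assms(1,4) by (simp add: real_sqrt_divide field_simps)
  finally show ?thesis
    by (rule mult_left_le_imp_le) (use assms(1,4) in simp)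
qed

text \<open>Walking between \<open>y\<close> and \<open>z\<close> in unit steps, each step costs at
  most the bound of \<open>wmean_shift_one\<close>, which is uniform in \<open>f\<close> and
  therefore applies to every translate of \<open>f\<close>.\<close>

lemma wmean_shift:
  fixes f :: "nat \<Rightarrow> real" and h :: "nat \<Rightarrow> nat"
  assumes "b > 1" "h 0 = (0::nat)" "h 1 = 1" "M > 0" and f: "\<And>s. 0 \<le> f s" "\<And>s. f s \<le> 1"
  defines "g \<equiv> \<lambda>z. wmean b M (\<lambda>xs. f (z + sum_list (map h xs)))"
  shows "\<bar>g y - g z\<bar> \<le> 2 * sqrt (real b / real M) * \<bar>real y - real z\<bar>"
proof -
  have up: "\<bar>g (z + k) - g z\<bar> \<le> 2 * sqrt (real b / real M) * real k" for z k
  proof (induction k)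
    case (Suc k)
    have "\<bar>g (z + k + 1) - g (z + k)\<bar> \<le> 2 * sqrt (real b / real M)"
      using wmean_shift_one[OF assms(1-4), of "\<lambda>s. f (z + k + s)"] f by (simp add: g_def algebra_simps)
    with Suc show ?case by (simp add: algebra_simps)
  qed simp
  show ?thesis
    using up[of z "y - z"] up[of y "z - y"]
    by (cases "y \<le> z") (simp_all add: abs_minus_commute of_nat_diff)
qed

text \<open>Grouping by the residue modulo \<open>q\<close>. With \<open>q = b\<close> this strips
  the last digit; in \<open>wmean_smoothing\<close> it separates a shift into a multiple of
  \<open>q\<close> and a small remainder.\<close>

lemma sum_lessThan_mult:
  fixes G :: "nat \<Rightarrow> real"
  shows "(\<Sum>y<q * R. G y) = (\<Sum>d<q. \<Sum>t<R. G (q * t + d))"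
proof -
  have "(\<Sum>y=t * q..<t * q + q. G y) = (\<Sum>d<q. G (q * t + d))" for t
    using sum.shift_bounds_nat_ivl[of G 0 "t * q" q]
    by (simp add: add.commute mult.commute lessThan_atLeast0)
  then have "(\<Sum>y<q * R. G y) = (\<Sum>t<R. \<Sum>d<q. G (q * t + d))"
    using sum.nat_group[of G q R] by (simp add: mult.commute)
  then show ?thesis using sum.swap[of "\<lambda>d t. G (q * t + d)" "{..<R}" "{..<q}"] by simp
qed

section \<open>Digit sums of integers\<close>

text \<open>The real end points of an \<open>int_interval\<close> need not be integers, so the least
  and greatest elements replace them; these exist since the cardinality is positive.\<close>

lemma strict_interval_obtain:
  assumes "strict_interval b n I" "b > 1"
  obtains a L where "I = {a..<a + L}" "L > 0" "b ^ (n - 1) \<le> a" "a + L \<le> b ^ n"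
    "real L = real b powr (3 * real n / 4)"
proof -
  obtain u v where I: "I = int_interval u v" and sub: "I \<subseteq> {b^(n-1) .. b^n - 1}"
    and card: "real (card I) = real b powr (3 * real n / 4)"
    using assms(1) unfolding strict_interval_def by blast
  have fin: "finite I" using sub finite_subset by blast
  have pos: "real b powr (3 * real n / 4) > 0" using assms(2) by simp
  then have "I \<noteq> {}" using card by auto
  then have mem: "Min I \<in> I" "Max I \<in> I" using fin by auto
  define lo hi where "lo = Min I" and "hi = Max I"
  have eq: "I = {lo..hi}"
  proof
    show "I \<subseteq> {lo..hi}" using fin by (auto simp: lo_def hi_def)
    show "{lo..hi} \<subseteq> I"
      using mem unfolding lo_def[symmetric] hi_def[symmetric]
      by (auto simp: I int_interval_def intro: order_trans)
  qed
  let ?L = "hi + 1 - lo"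
  have le: "lo \<le> hi" using mem fin by (simp add: lo_def hi_def)
  have I': "I = {lo..<lo + ?L}" unfolding eq using le by auto
  have "card I = ?L" unfolding eq by simp
  then have "real ?L = real b powr (3 * real n / 4)" using card by simp
  moreover have "b ^ (n - 1) \<le> lo" using sub mem(1) by (auto simp: lo_def)
  moreover have "hi \<le> b ^ n - 1" using sub mem(2) by (auto simp: hi_def)
  moreover have "0 < b ^ n" using assms(2) by simp
  ultimately show ?thesis
    by (intro that[OF I']) (use le in linarith)+
qed

lemma happyH_digit:
  assumes "b > 1" "h 0 = 0" "d < b"
  shows "happyH b h (b * y + d) = h d + happyH b h y"
proof (cases "b * y + d = 0")
  case True
  then show ?thesis using assms by (simp add: happyH.simps)
next
  case False
  then show ?thesis using assms happyH.simps[of b h "b * y + d"]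
    by (simp only: mod_mult_self4 div_mult_self4 mod_less div_less) auto
qed

lemma happyH_0: "happyH b h 0 = 0"
  by (simp add: happyH.simps)

text \<open>The number \<open>y\<close> fills its \<open>m\<close> places with leading zeros, which
  contribute nothing because \<open>h 0 = 0\<close>.\<close>

lemma happyH_prefix:
  assumes "b > 1" "h 0 = 0" "y < b ^ m"
  shows "happyH b h (p * b ^ m + y) = happyH b h p + happyH b h y"
  using assms(3)
proof (induction m arbitrary: y)
  case 0
  then show ?case by (simp add: happyH_0)
next
  case (Suc m)
  define d y' where "d = y mod b" and "y' = y div b"
  have y: "y = b * y' + d" and d: "d < b"
    using assms by (simp_all add: d_def y'_def)
  have "y' < b ^ m"
    using Suc.prems assms(1) by (simp add: y'_def less_mult_imp_div_less mult.commute)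
  then have "happyH b h (b * (p * b ^ m + y') + d) = happyH b h p + happyH b h y"
    using Suc.IH[of y'] happyH_digit[of b h d "p * b ^ m + y'"] happyH_digit[of b h d y'] assms d y by simp
  moreover have "p * b ^ Suc m + y = b * (p * b ^ m + y') + d"
    by (simp add: y algebra_simps)
  ultimately show ?case by (simp only:)
qed

lemma exists_prefix:
  assumes "b > 1" "h 0 = 0" "h 1 = 1" "1 \<le> k" "k \<le> n"
  obtains p where "b ^ (n - 1) \<le> p" "p < b ^ n" "happyH b h p = k"
proof -
  \<comment> \<open>The witness consists of \<open>k\<close> digits 1, and the induction step
    appends one more. Padding it with \<open>n - k\<close> zeros afterwards adjusts the length and
    keeps the digit sum.\<close>
  have "\<exists>r. b ^ (k - 1) \<le> r \<and> r < b ^ k \<and> happyH b h r = k"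
    using assms(4)
  proof (induction k rule: dec_induct)
    case base
    then show ?case using assms happyH_digit[of b h 1 0]
      by (intro exI[of _ 1]) (simp add: happyH_0)
  next
    case (step k)
    then obtain r where r: "b ^ (k - 1) \<le> r" "r < b ^ k" "happyH b h r = k" by blast
    have "b ^ k \<le> b * r + 1"
    proof -
      have "b ^ k = b * b ^ (k - 1)" using step by (simp flip: power_Suc)
      also have "\<dots> \<le> b * r" using r(1) by (rule mult_le_mono2)
      finally show ?thesis by simp
    qed
    moreover have "b * r + 1 < b ^ Suc k"
    proof -
      have "b * (r + 1) \<le> b * b ^ k" using r(2) by (intro mult_le_mono2) simp
      then show ?thesis using assms(1) by simp
    qed
    moreover have "happyH b h (b * r + 1) = Suc k"
      using happyH_digit[of b h 1 r] assms r by simp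
    ultimately show ?case by (intro exI[of _ "b * r + 1"]) simp
  qed
  then obtain r where r: "b ^ (k - 1) \<le> r" "r < b ^ k" "happyH b h r = k" by blast
  have "b ^ (n - 1) = b ^ (k - 1) * b ^ (n - k)" "b ^ n = b ^ k * b ^ (n - k)"
    using assms by (simp_all flip: power_add)
  moreover have "happyH b h (r * b ^ (n - k)) = k"
    using happyH_prefix[of b h 0 "n - k" r] assms r by (simp add: happyH_0)
  ultimately show ?thesis
    using that[of "r * b ^ (n - k)"] r assms(1) by simp
qed

text \<open>Words of length \<open>M\<close> are the numbers below \<open>b ^ M\<close> padded with
  zeros. The first letter plays the least significant digit, in line with the recursion of
  \<open>happyH\<close>.\<close>

lemma wmean_eq_happyH:
  assumes "b > 1" "h 0 = 0"
  shows "wmean b M (\<lambda>xs. f (sum_list (map h xs))) = (\<Sum>y<b ^ M. f (happyH b h y)) / real b ^ M"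
proof (induction M arbitrary: f)
  case 0
  then show ?case by (simp add: happyH_0)
next
  case (Suc M)
  have "(\<Sum>y<b ^ Suc M. f (happyH b h y)) = (\<Sum>d<b. \<Sum>y<b ^ M. f (h d + happyH b h y))"
    using sum_lessThan_mult[of "\<lambda>y. f (happyH b h y)" b "b ^ M"] happyH_digit[of b h] assms
    by simp
  then show ?case
    using Suc.IH[of "\<lambda>s. f (h _ + s)"] by (simp add: sum_divide_distrib mult.commute)
qed

lemma typeC_happyH: "typeC b h C (happyH b h n) \<Longrightarrow> typeC b h C n"
  unfolding typeC_def
proof (elim exE)
  fix k assume "(happyH b h ^^ k) (happyH b h n) \<in> C"
  then have "(happyH b h ^^ Suc k) n \<in> C" by (simp only: funpow_Suc_right comp_apply)
  then show "\<exists>k. (happyH b h ^^ k) n \<in> C" ..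
qed

section \<open>Chebyshev's inequality for digit sums\<close>

lemma wmean_digit_variance:
  assumes "b > 0"
  shows "wmean b m (\<lambda>xs. (real (sum_list (map h xs)) - real m * digit_mean b h)\<^sup>2) =
    real m * (digit_sd b h)\<^sup>2"
proof -
  have "real (sum_list (map h xs)) = (\<Sum>x\<leftarrow>xs. real (h x))" for xs
    by (induction xs) simp_all
  then show ?thesis
    using wmean_variance[OF assms(1), of m "\<lambda>x. real (h x)"]
    by (simp add: digit_mean_def digit_sd_def sum_nonneg)
qed

text \<open>If the digit sum is within \<open>t\<close> of its mean, then the \<open>K\<close>
  consecutive shifted values cover the whole interval and so meet every element of \<open>A\<close>.
  Chebyshev's inequality controls the remaining words.\<close>

lemma wmean_covering:
  fixes h :: "nat \<Rightarrow> nat"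
  assumes "b > 0" and A: "A \<subseteq> {a..<a + L}" and t: "t > 0"
    and lo: "real k0 + real m * digit_mean b h + t \<le> real a"
    and hi: "real a + real L \<le> real k0 + real m * digit_mean b h - t + real K"
  shows "real (card A) * (1 - real m * (digit_sd b h)\<^sup>2 / t\<^sup>2) \<le>
    (\<Sum>k<K. wmean b m (\<lambda>xs. of_bool (k0 + k + sum_list (map h xs) \<in> A)))"
proof -
  let ?S = "\<lambda>xs. sum_list (map h xs)" and ?\<mu> = "digit_mean b h"
  \<comment> \<open>Chebyshev in pointwise form: the indicator of a small deviation is bounded below
    by 1 minus the squared deviation over \<open>t\<^sup>2\<close>, so only the variance has to be
    averaged.\<close>
  have pointwise: "real (card A) * (1 - (1 / t\<^sup>2) * (real (?S xs) - real m * ?\<mu>)\<^sup>2) \<le>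
      (\<Sum>k<K. of_bool (k0 + k + ?S xs \<in> A))" for xs
  proof (cases "\<bar>real (?S xs) - real m * ?\<mu>\<bar> \<le> t")
    case True
    have bounds: "real (k0 + ?S xs) \<le> real a" "real (a + L) \<le> real (k0 + ?S xs + K)"
      using True lo hi by (simp_all add: abs_le_iff)
    have "A = (\<lambda>k. k0 + k + ?S xs) ` {k \<in> {..<K}. k0 + k + ?S xs \<in> A}"
    proof (intro equalityI subsetI)
      fix x assume x: "x \<in> A"
      then have "a \<le> x" "x < a + L" using A by auto
      with bounds have "k0 + ?S xs \<le> x" "x < k0 + ?S xs + K" by linarith+
      then show "x \<in> (\<lambda>k. k0 + k + ?S xs) ` {k \<in> {..<K}. k0 + k + ?S xs \<in> A}"
        using x by (intro image_eqI[of _ _ "x - (k0 + ?S xs)"]) auto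
    qed auto
    from arg_cong[OF this, of card] have "card A \<le> card {k \<in> {..<K}. k0 + k + ?S xs \<in> A}"
      using card_image_le[of "{k \<in> {..<K}. k0 + k + ?S xs \<in> A}" "\<lambda>k. k0 + k + ?S xs"] by simp
    also have "real (card {k \<in> {..<K}. k0 + k + ?S xs \<in> A}) = (\<Sum>k<K. of_bool (k0 + k + ?S xs \<in> A))"
      by (simp add: of_bool_def sum.If_cases Int_def)
    finally show ?thesis
      by (intro order_trans[OF mult_left_le]) auto
  next
    case False
    then have "t\<^sup>2 \<le> (real (?S xs) - real m * ?\<mu>)\<^sup>2"
      using t by (intro abs_le_square_iff[THEN iffD1]) simp
    then have "1 \<le> (1 / t\<^sup>2) * (real (?S xs) - real m * ?\<mu>)\<^sup>2"
      using t by (simp add: field_simps)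
    then have "real (card A) * (1 - (1 / t\<^sup>2) * (real (?S xs) - real m * ?\<mu>)\<^sup>2) \<le> 0"
      by (intro mult_nonneg_nonpos) auto
    also have "\<dots> \<le> (\<Sum>k<K. of_bool (k0 + k + ?S xs \<in> A))" by (intro sum_nonneg) simp
    finally show ?thesis .
  qed
  have "real (card A) * (1 - real m * (digit_sd b h)\<^sup>2 / t\<^sup>2) =
      wmean b m (\<lambda>xs. real (card A) * (1 - (1 / t\<^sup>2) * (real (?S xs) - real m * ?\<mu>)\<^sup>2))"
    by (simp only: wmean_cmult wmean_diff wmean_const[OF assms(1)] wmean_digit_variance[OF assms(1)]) simp
  also have "\<dots> \<le> wmean b m (\<lambda>xs. \<Sum>k<K. of_bool (k0 + k + ?S xs \<in> A))"
    using pointwise by (rule wmean_mono)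
  also have "\<dots> = (\<Sum>k<K. wmean b m (\<lambda>xs. of_bool (k0 + k + ?S xs \<in> A)))"
    by (rule wmean_sum)
  finally show ?thesis .
qed

section \<open>Numerical consequences of the bound (B)\<close>

locale happy_function =
  fixes b :: nat and h :: "nat \<Rightarrow> nat"
  assumes b_gt_1: "b > 1" and h0: "h 0 = 0" and h1: "h 1 = 1"
begin

abbreviation \<mu> :: real where "\<mu> \<equiv> digit_mean b h"
abbreviation \<sigma> :: real where "\<sigma> \<equiv> digit_sd b h"

text \<open>The powers of \<open>b\<close> in (B1), (B3) and the final exponent are integral powers
  of this number, which turns the estimates into polynomial ones.\<close>

definition scale :: "nat \<Rightarrow> real" where
  "scale n = real b powr (real n / 8)"

lemma scale_powers:
  "scale n > 1 \<longleftrightarrow> n > 0" "scale n > 0" "scale n ^ 8 = real b ^ n"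
  "real b powr (5 * real n / 8) = scale n ^ 5" "real b powr (3 * real n / 4) = scale n ^ 6"
  "real b powr (real n / 4) = (scale n)\<^sup>2"
proof -
  have *: "scale n ^ k = real b powr (real k * real n / 8)" for k
    using b_gt_1 by (simp add: scale_def powr_powr mult.commute flip: powr_realpow)
  show "scale n ^ 8 = real b ^ n" using *[of 8] b_gt_1 by (simp add: powr_realpow)
  show "real b powr (5 * real n / 8) = scale n ^ 5" using *[of 5] by simp
  show "real b powr (3 * real n / 4) = scale n ^ 6" using *[of 6] by simp
  show "real b powr (real n / 4) = (scale n)\<^sup>2" using *[of 2] by simp
  show "scale n > 1 \<longleftrightarrow> n > 0" using b_gt_1 by (cases "n = 0") (auto simp: scale_def)
  show "scale n > 0" using b_gt_1 by (simp add: scale_def)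
qed

lemma b_mean: "real b * \<mu> = real (\<Sum>j<b. h j)"
  using b_gt_1 by (simp add: digit_mean_def)

lemma b_mean_ge_1: "real b * \<mu> \<ge> 1"
proof -
  have "h 1 \<le> (\<Sum>j<b. h j)" using b_gt_1 by (intro member_le_sum) auto
  then show ?thesis unfolding b_mean using h1 by (simp del: of_nat_sum)
qed

lemma mean_pos: "\<mu> > 0"
  using b_mean_ge_1 zero_less_mult_pos[of "real b" \<mu>] b_gt_1 by simp

text \<open>Only the digits 0 and 1, whose values are prescribed, are kept. This already makes
  \<open>\<sigma>\<close> positive and is strong enough for \<open>rounding_le\<close>.\<close>

lemma b_variance_ge: "real b * \<sigma>\<^sup>2 \<ge> \<mu>\<^sup>2 + (1 - \<mu>)\<^sup>2"
proof -
  have "(\<Sum>j\<in>{0,1}. (real (h j) - \<mu>)\<^sup>2) \<le> (\<Sum>j<b. (real (h j) - \<mu>)\<^sup>2)"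
    using b_gt_1 by (intro sum_mono2) auto
  moreover have "real b * \<sigma>\<^sup>2 = (\<Sum>j<b. (real (h j) - \<mu>)\<^sup>2)"
    using b_gt_1 by (simp add: digit_sd_def sum_nonneg)
  ultimately show ?thesis using h0 h1 by simp
qed

lemma sd_pos: "\<sigma> > 0"
proof -
  have "0 < \<mu>\<^sup>2 + (1 - \<mu>)\<^sup>2" using mean_pos by (intro add_pos_nonneg) auto
  then have "\<sigma> \<noteq> 0" using b_variance_ge by auto
  moreover have "\<sigma> \<ge> 0" by (simp add: digit_sd_def sum_nonneg)
  ultimately show ?thesis by simp
qed

definition bounded_scale :: "nat \<Rightarrow> bool" where
  "bounded_scale n \<longleftrightarrow> n > 0 \<and>
    4 * (1 + 3 * \<mu> + sqrt 2 * \<sigma> * scale n ^ 5) \<le> real b ^ (n - 1) \<and>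
    4 * \<mu> * (3 * \<mu> + 1 + scale n ^ 6 + 2 * \<sigma> / sqrt \<mu> * scale n ^ 5) \<le> real b ^ (n - 1)"

text \<open>Passing to \<open>n'\<close> multiplies the right sides by the eighth power of a number
  \<open>?u\<close> that is at least 1, but the terms on the left by at most its sixth
  power.\<close>

lemma bounded_scale_mono:
  assumes "bounded_scale n" "n \<le> n'"
  shows "bounded_scale n'"
proof -
  let ?u = "scale (n' - n)"
  have z: "scale n' = scale n * ?u"
    using assms(2) by (simp add: scale_def of_nat_diff diff_divide_distrib flip: powr_add)
  have u: "1 \<le> ?u" using b_gt_1 by (simp add: scale_def ge_one_powr_ge_zero)
  have X: "real b ^ (n' - 1) = real b ^ (n - 1) * ?u ^ 8"
    using assms scale_powers(3)[of "n' - n"] by (simp add: bounded_scale_def flip: power_add)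
  have grow: "A + B * scale n' ^ 5 + D * scale n' ^ 6 \<le> real b ^ (n' - 1)"
    if "A + B * scale n ^ 5 + D * scale n ^ 6 \<le> real b ^ (n - 1)" "0 \<le> A" "0 \<le> B" "0 \<le> D" for A B D
  proof -
    have "A + B * scale n' ^ 5 + D * scale n' ^ 6
        = A * 1 + B * scale n ^ 5 * ?u ^ 5 + D * scale n ^ 6 * ?u ^ 6"
      by (simp add: z power_mult_distrib)
    also have "\<dots> \<le> A * ?u ^ 8 + B * scale n ^ 5 * ?u ^ 8 + D * scale n ^ 6 * ?u ^ 8"
      using that(2-4) u scale_powers(2)[of n]
      by (intro add_mono mult_left_mono power_increasing one_le_power) auto
    also have "\<dots> = (A + B * scale n ^ 5 + D * scale n ^ 6) * ?u ^ 8"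
      by (simp add: algebra_simps)
    also have "\<dots> \<le> real b ^ (n' - 1)"
      unfolding X using that(1) u by (intro mult_right_mono) auto
    finally show ?thesis .
  qed
  show ?thesis
    using assms grow[of "4 * (1 + 3 * \<mu>)" "4 * (sqrt 2 * \<sigma>)" 0]
      grow[of "4 * \<mu> * (3 * \<mu> + 1)" "4 * \<mu> * (2 * \<sigma> / sqrt \<mu>)" "4 * \<mu>"] mean_pos sd_pos
    by (simp add: bounded_scale_def algebra_simps)
qed

text \<open>The deviation allowed for in Chebyshev's inequality. Using the left end \<open>a\<close> of the interval instead
  of the cruder \<open>b ^ n\<close> makes (B1) sufficient for \<open>margin_le_quarter\<close> also when \<open>\<mu> < 1 / 2\<close>.\<close>

definition margin :: "nat \<Rightarrow> nat \<Rightarrow> real" where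
  "margin n a = \<sigma> * sqrt (real a / \<mu>) * scale n"

section \<open>Estimates for a fixed \<open>n\<close> and left end \<open>a\<close>\<close>

context
  fixes n a :: nat
  assumes bounded: "bounded_scale n" and a_ge: "b ^ (n - 1) \<le> a" and a_le: "a \<le> b ^ n"
begin

lemma real_a_ge: "real b ^ (n - 1) \<le> real a"
  using a_ge by (metis of_nat_le_iff of_nat_power)

lemma real_a_pos: "real a > 0"
  by (rule less_le_trans[OF _ real_a_ge]) (use b_gt_1 in simp)

lemma real_a_le: "real a \<le> scale n ^ 8"
  using a_le scale_powers(3)[of n] by (metis of_nat_le_iff of_nat_power)

lemma b_times_power: "real b * real b ^ (n - 1) = scale n ^ 8"
  using bounded scale_powers(3)[of n] by (simp add: bounded_scale_def flip: power_Suc)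

lemma margin_pos: "margin n a > 0"
  using real_a_pos mean_pos sd_pos scale_powers(2)[of n] by (simp add: margin_def)

lemma margin_square: "(margin n a)\<^sup>2 = \<sigma>\<^sup>2 * (real a / \<mu>) * (scale n)\<^sup>2"
  using real_a_pos mean_pos by (simp add: margin_def power_mult_distrib)

text \<open>Write \<open>X\<close> for \<open>b ^ (n - 1)\<close>. Inserting
  \<open>1 / \<mu> \<le> b\<close>, \<open>1 \<le> a / X\<close> and
  \<open>b * X = scale n ^ 8\<close> into \<open>margin_square\<close> gives a bound linear in
  \<open>a\<close>, to which (B1) applies. The spare 1 pays for the prefix, which contains at least
  one digit 1.\<close>

lemma margin_le_quarter: "margin n a \<le> real a / 4 - 1"
proof -
  let ?z = "scale n" and ?X = "real b ^ (n - 1)"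
  have X: "?X > 0" using b_gt_1 by simp
  have "4 * (1 + 3 * \<mu> + sqrt 2 * \<sigma> * ?z ^ 5) \<le> ?X"
    using bounded by (simp add: bounded_scale_def)
  moreover have "1 * (\<sigma> * ?z ^ 5) \<le> sqrt 2 * (\<sigma> * ?z ^ 5)"
    using sd_pos scale_powers(2)[of n] by (intro mult_right_mono) auto
  ultimately have s: "\<sigma> * ?z ^ 5 \<le> ?X / 4 - 1"
    using mean_pos by (simp add: mult.assoc)
  have "(margin n a)\<^sup>2 \<le> (real a * (\<sigma> * ?z ^ 5) / ?X)\<^sup>2"
  proof -
    have "(margin n a)\<^sup>2 = \<sigma>\<^sup>2 * ?z\<^sup>2 * real a * (1 / \<mu>)"
      by (simp add: margin_square)
    also have "\<dots> \<le> \<sigma>\<^sup>2 * ?z\<^sup>2 * real a * (real b * (real a / ?X))"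
    proof (intro mult_left_mono)
      have "1 / \<mu> \<le> real b" using b_mean_ge_1 mean_pos by (simp add: field_simps)
      also have "\<dots> \<le> real b * (real a / ?X)"
        using mult_left_mono[of 1 "real a / ?X" "real b"] real_a_ge X by (simp add: field_simps)
      finally show "1 / \<mu> \<le> real b * (real a / ?X)" .
    qed auto
    also have "\<dots> = \<sigma>\<^sup>2 * ?z\<^sup>2 * (real a)\<^sup>2 * (real b * ?X) / ?X\<^sup>2"
      using X by (simp add: power2_eq_square)
    also have "\<dots> = (real a * (\<sigma> * ?z ^ 5) / ?X)\<^sup>2"
      unfolding b_times_power by (simp add: power_mult_distrib power_divide flip: power_mult power_add)
    finally show ?thesis .
  qed
  then have "margin n a \<le> real a * (\<sigma> * ?z ^ 5) / ?X"
    by (rule power2_le_imp_le) (use sd_pos scale_powers(2)[of n] X in auto)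
  also have "\<dots> \<le> real a * (?X / 4 - 1) / ?X"
    using s X by (intro divide_right_mono mult_left_mono) auto
  also have "\<dots> = real a / 4 - real a / ?X"
  proof -
    have "x * (y / 4 - 1) / y = x / 4 - x / y" if "y > 0" for x y :: real
      using that by (simp add: field_simps)
    then show ?thesis using X .
  qed
  also have "\<dots> \<le> real a / 4 - 1" using real_a_ge X by simp
  finally show ?thesis .
qed

lemma margin_le: "margin n a \<le> \<sigma> / sqrt \<mu> * scale n ^ 5"
proof -
  have "sqrt (real a) \<le> scale n ^ 4"
    using real_a_le scale_powers(2)[of n] by (intro real_le_lsqrt) (auto simp flip: power_mult)
  then have "\<sigma> / sqrt \<mu> * scale n * sqrt (real a) \<le> \<sigma> / sqrt \<mu> * scale n * scale n ^ 4"
    using sd_pos mean_pos scale_powers(2)[of n] by (intro mult_left_mono) auto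
  also have "\<dots> = \<sigma> / sqrt \<mu> * scale n ^ 5" by (simp add: mult.assoc flip: power_Suc)
  finally show ?thesis
    by (simp add: margin_def real_sqrt_divide mult_ac)
qed

text \<open>The margin is \<open>scale n\<close> times an upper bound for the standard deviation of
  \<open>m\<close> digits, as \<open>m\<close> is at most \<open>a / \<mu>\<close>.\<close>

lemma chebyshev_margin:
  assumes "real m * \<mu> \<le> real a"
  shows "real m * \<sigma>\<^sup>2 / (margin n a)\<^sup>2 \<le> 1 / (scale n)\<^sup>2"
proof -
  have "real m * \<sigma>\<^sup>2 / (margin n a)\<^sup>2 = (real m * \<mu> / real a) / (scale n)\<^sup>2"
    using sd_pos mean_pos real_a_pos by (simp add: margin_square)
  also have "\<dots> \<le> 1 / (scale n)\<^sup>2"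
    using assms real_a_pos by (intro divide_right_mono) auto
  finally show ?thesis .
qed

text \<open>Lets the rounding errors in the number of shifts be absorbed by a second copy of the
  main error term. Multiply \<open>\<mu> * (3 * \<mu> + 1) \<le> X / 4\<close> from (B3), with
  \<open>X = b ^ (n - 1)\<close>, by the variance bound for \<open>3 * \<mu> + 1\<close>, and use
  \<open>b * X = scale n ^ 8\<close>.\<close>

lemma rounding_le: "3 * \<mu> + 1 \<le> 2 * \<sigma> / sqrt \<mu> * scale n ^ 5"
proof -
  let ?z = "scale n" and ?X = "real b ^ (n - 1)"
  have z1: "?z\<^sup>2 \<ge> 1" using scale_powers(1)[of n] bounded by (simp add: bounded_scale_def)
  have nn: "0 \<le> 4 * \<mu> * (scale n ^ 6 + 2 * \<sigma> / sqrt \<mu> * scale n ^ 5)"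
    using mean_pos sd_pos scale_powers(2)[of n] by simp
  have B: "4 * (\<mu> * (3 * \<mu> + 1)) \<le> ?X"
    using bounded nn by (simp add: bounded_scale_def algebra_simps)
  have "(3 * \<mu> + 1) \<le> 16 * (\<mu>\<^sup>2 + (1 - \<mu>)\<^sup>2)"
    using zero_le_power2[of "\<mu> - 1/2"] zero_le_power2[of "\<mu> - 1"] by (simp add: power2_eq_square algebra_simps)
  also have "\<dots> \<le> 16 * (real b * \<sigma>\<^sup>2 * ?z\<^sup>2)"
    using b_variance_ge mult_left_mono[OF z1, of "real b * \<sigma>\<^sup>2"] by simp
  finally have q: "3 * \<mu> + 1 \<le> 16 * (real b * \<sigma>\<^sup>2 * ?z\<^sup>2)" .
  have "\<mu> * (3 * \<mu> + 1)\<^sup>2 = (\<mu> * (3 * \<mu> + 1)) * (3 * \<mu> + 1)" by (simp add: power2_eq_square)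
  also have "\<dots> \<le> (?X / 4) * (16 * (real b * \<sigma>\<^sup>2 * ?z\<^sup>2))"
    using B q mean_pos by (intro mult_mono) auto
  also have "\<dots> = 4 * \<sigma>\<^sup>2 * (?z\<^sup>2 * (real b * ?X))" by simp
  also have "\<dots> = (2 * \<sigma> * ?z ^ 5)\<^sup>2"
    unfolding b_times_power by (simp add: power_mult_distrib flip: power_mult power_add)
  finally have "(sqrt \<mu> * (3 * \<mu> + 1))\<^sup>2 \<le> (2 * \<sigma> * ?z ^ 5)\<^sup>2"
    using mean_pos by (simp add: power_mult_distrib)
  then have "sqrt \<mu> * (3 * \<mu> + 1) \<le> 2 * \<sigma> * ?z ^ 5"
    by (rule power2_le_imp_le) (use sd_pos scale_powers(2)[of n] in auto)
  then show ?thesis using mean_pos by (simp add: field_simps)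
qed

lemma scale_square_ge_2: "(scale n)\<^sup>2 \<ge> 2"
proof -
  have "0 \<le> sqrt 2 * \<sigma> * scale n ^ 5" using sd_pos scale_powers(2)[of n] by simp
  then have "4 * (1 + 3 * \<mu>) \<le> real b ^ (n - 1)"
    using bounded by (simp add: bounded_scale_def)
  then have "real b * (4 * (1 + 3 * \<mu>)) \<le> scale n ^ 8"
    unfolding b_times_power[symmetric] by (intro mult_left_mono) auto
  moreover have "real b * (4 * (1 + 3 * \<mu>)) = 4 * real b + 12 * (real b * \<mu>)" by (simp add: algebra_simps)
  ultimately have "2 ^ 4 \<le> ((scale n)\<^sup>2) ^ 4"
    using b_mean_ge_1 b_gt_1 by (simp flip: power_mult)
  then show ?thesis by (subst (asm) power_mono_iff) auto
qed

end

end

section \<open>From one strict interval to a longer one\<close>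

lemma exists_ge_average:
  fixes g :: "nat \<Rightarrow> real"
  assumes "K > 0" "s \<le> (\<Sum>k<K. g k)"
  obtains k where "k < K" "s / real K \<le> g k"
proof (rule ccontr)
  assume "\<not> thesis"
  then have "\<forall>k<K. g k < s / real K" using that by force
  then have "(\<Sum>k<K. g k) < (\<Sum>k<K. s / real K)"
    using assms(1) by (intro sum_strict_mono) auto
  then show False using assms by simp
qed

text \<open>Converts the Chebyshev factor \<open>1 - 1 / z\<^sup>2\<close> into an exponential, so
  that losses can be added.\<close>

lemma exp_minus_double_le:
  fixes x :: real
  assumes "0 \<le> x" "x \<le> 1 / 2"
  shows "exp (- 2 * x) \<le> 1 - x"
proof -
  have "x\<^sup>2 \<le> x * (1 / 2)" using assms mult_left_mono[of x "1/2" x] by (simp add: power2_eq_square)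
  then have "- 2 * x \<le> ln (1 - x)"
    using ln_one_minus_pos_lower_bound[OF assms] by simp
  then have "exp (- 2 * x) \<le> exp (ln (1 - x))" by (simp only: exp_le_cancel_iff)
  then show ?thesis using assms by simp
qed

context happy_function
begin

lemma wmean_count:
  "wmean b m (\<lambda>xs. of_bool (k + sum_list (map h xs) \<in> A)) =
    real (card {y \<in> {..<b ^ m}. k + happyH b h y \<in> A}) / real b ^ m"
  using wmean_eq_happyH[of b h m "\<lambda>s. of_bool (k + s \<in> A)"] b_gt_1 h0
  by (simp add: of_bool_def sum.If_cases Int_def)

text \<open>Crude growth that makes the new interval at least twice as far out in digits:
  \<open>b\<close> to the power 3/4 is at least 3/2, and Bernoulli's inequality does the
  rest.\<close>

lemma scale_power6_ge: "real n / 2 \<le> scale n ^ 6"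
proof -
  let ?s = "scale 1"
  have n: "scale n = ?s ^ n" using b_gt_1 by (simp add: scale_def powr_power)
  have "(2::real) ^ 3 \<le> real b ^ 3" using b_gt_1 by (intro power_mono) auto
  also have "\<dots> = (?s ^ 8) ^ 3" using scale_powers(3)[of 1] by simp
  also have "\<dots> = (?s ^ 6) ^ 4" by (simp flip: power_mult)
  finally have "(3 / 2) ^ 4 \<le> (?s ^ 6) ^ 4" by (simp add: power_divide)
  then have "3 / 2 \<le> ?s ^ 6" using scale_powers(2)[of 1] by (subst (asm) power_mono_iff) auto
  then have "(3 / 2) ^ n \<le> (?s ^ 6) ^ n" by (intro power_mono) auto
  also have "\<dots> = scale n ^ 6" unfolding n by (simp add: mult.commute flip: power_mult)
  finally show ?thesis using Bernoulli_inequality[of "1 / 2 :: real" n] by simp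
qed

text \<open>One quarter of the \<open>4 * N\<close> digits is fixed and three quarters are free,
  which is exactly the length demanded of a strict interval.\<close>

lemma strict_interval_prefix:
  assumes "b ^ (N - 1) \<le> p" "p < b ^ N" "N > 0"
  shows "strict_interval b (4 * N) {p * b ^ (3 * N)..<p * b ^ (3 * N) + b ^ (3 * N)}"
  unfolding strict_interval_def
proof (intro conjI)
  let ?q = "b ^ (3 * N)"
  have q: "?q > 0" using b_gt_1 by simp
  have "{p * ?q..<p * ?q + ?q} = int_interval (real (p * ?q)) (real (p * ?q + ?q - 1))"
    using q unfolding int_interval_def of_nat_le_iff by (auto, linarith)
  then show "\<exists>a c. {p * ?q..<p * ?q + ?q} = int_interval a c" by blast
  have "b ^ (4 * N - 1) = b ^ (N - 1) * ?q"
    using assms(3) by (simp flip: power_add)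
  then have lo: "b ^ (4 * N - 1) \<le> p * ?q" using assms(1) by simp
  have "(p + 1) * ?q \<le> b ^ N * ?q" using assms(2) by (intro mult_le_mono1) simp
  also have "\<dots> = b ^ (4 * N)" by (simp flip: power_add)
  finally have "p * ?q + ?q \<le> b ^ (4 * N)" by simp
  with lo show "{p * ?q..<p * ?q + ?q} \<subseteq> {b ^ (4 * N - 1)..b ^ (4 * N) - 1}" by auto
  show "real (card {p * ?q..<p * ?q + ?q}) = real b powr (3 * real (4 * N) / 4)"
    using powr_realpow[of "real b" "3 * N"] b_gt_1 by simp
qed

lemma typeC_density_prefix_ge:
  assumes "happyH b h p = k" and A: "\<And>x. x \<in> A \<Longrightarrow> typeC b h C x"
  shows "wmean b m (\<lambda>xs. of_bool (k + sum_list (map h xs) \<in> A)) \<le>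
    typeC_density b h C {p * b ^ m..<p * b ^ m + b ^ m}"
proof -
  let ?I = "{p * b ^ m..<p * b ^ m + b ^ m}"
  have "(\<lambda>y. p * b ^ m + y) ` {y \<in> {..<b ^ m}. k + happyH b h y \<in> A} \<subseteq> {x \<in> ?I. typeC b h C x}"
  proof safe
    fix y assume y: "y < b ^ m" "k + happyH b h y \<in> A"
    have "typeC b h C (happyH b h (p * b ^ m + y))"
      using happyH_prefix[of b h y m p] b_gt_1 h0 y assms(1) A by simp
    then show "typeC b h C (p * b ^ m + y)" by (rule typeC_happyH)
  qed auto
  then have "card ((\<lambda>y. p * b ^ m + y) ` {y \<in> {..<b ^ m}. k + happyH b h y \<in> A}) \<le>
      card {x \<in> ?I. typeC b h C x}"
    by (intro card_mono) auto
  then have "card {y \<in> {..<b ^ m}. k + happyH b h y \<in> A} \<le> card {x \<in> ?I. typeC b h C x}"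
    by (subst (asm) card_image) (auto simp: inj_on_def)
  then show ?thesis
    by (simp add: wmean_count typeC_density_def divide_right_mono)
qed

lemma strict_step:
  assumes B: "bounded_scale n" and S: "strict_interval b n I"
  obtains n' I' where "2 * n \<le> n'" "strict_interval b n' I'"
    "typeC_density b h C I * exp (- 2 / (scale n)\<^sup>2 - 4 * \<sigma> / (sqrt \<mu> * scale n))
      \<le> typeC_density b h C I'"
proof -
  obtain a L where I: "I = {a..<a + L}" and "L > 0" and a: "b ^ (n - 1) \<le> a" "a + L \<le> b ^ n"
    and "real L = real b powr (3 * real n / 4)"
    using strict_interval_obtain[OF S b_gt_1] by metis
  then have L: "real L = scale n ^ 6" by (simp add: scale_powers)
  have a_le: "a \<le> b ^ n" using a(2) by simp
  note ctx = B a(1) a_le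
  define t z where "t = margin n a" and "z = scale n"
  have z: "z > 0" and z2: "z\<^sup>2 \<ge> 2"
    using scale_powers(2)[of n] scale_square_ge_2[OF ctx] by (simp_all add: z_def)
  have t: "t > 0" "t \<le> real a / 4 - 1" "t \<le> \<sigma> / sqrt \<mu> * z ^ 5"
    using margin_pos[OF ctx] margin_le_quarter[OF ctx] margin_le[OF ctx] by (simp_all add: t_def z_def)
  have \<mu>: "\<mu> > 0" by (rule mean_pos)
  \<comment> \<open>\<open>N\<close> is maximal such that \<open>3 * N\<close> free digits, at least
    one prefix 1 and the margin \<open>t\<close> keep the mean below \<open>a\<close>.
    \<open>K\<close> has to cover the interval (\<open>z ^ 6\<close>), the deviation on both sides
    (\<open>2 * t\<close>) and the rounding of \<open>N\<close> (\<open>3 * \<mu>\<close>).\<close>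
  define w where "w = (real a - t - 1) / (3 * \<mu>)"
  define N where "N = nat \<lfloor>w\<rfloor>"
  define K where "K = nat \<lceil>z ^ 6 + 2 * t + 3 * \<mu>\<rceil>"
  have "w \<ge> 0" using t \<mu> by (simp add: w_def)
  then have "real N \<le> w" "w < real N + 1" unfolding N_def by linarith+
  then have N: "3 * \<mu> * real N \<le> real a - t - 1" "real a - t - 1 < 3 * \<mu> * (real N + 1)"
    using \<mu> by (simp_all add: w_def field_simps)
  have "0 \<le> z ^ 6 + 2 * t + 3 * \<mu>" using z t \<mu> by simp
  then have K: "z ^ 6 + 2 * t + 3 * \<mu> \<le> real K" "real K < z ^ 6 + 2 * t + 3 * \<mu> + 1"
    unfolding K_def by linarith+
  have "0 < z ^ 6 + 2 * t + 3 * \<mu>" using z t \<mu> by (intro add_pos_pos) auto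
  then have K0: "K > 0" using K(1) by (cases K) auto
  \<comment> \<open>Up to \<open>K\<close> ones must fit into a prefix of \<open>N\<close> digits;
    this is what (B3) guarantees.\<close>
  have KN: "K \<le> N"
  proof -
    have "4 * \<mu> * real K \<le> 4 * \<mu> * (3 * \<mu> + 1 + z ^ 6 + 2 * \<sigma> / sqrt \<mu> * z ^ 5)"
      using K(2) t(3) \<mu> by (intro mult_left_mono) auto
    also have "\<dots> \<le> real b ^ (n - 1)" using B by (simp add: bounded_scale_def z_def)
    also have "\<dots> \<le> real a" by (rule real_a_ge[OF ctx])
    finally have "3 * \<mu> * real K \<le> 3 * (real a / 4)" by linarith
    also have "\<dots> < 3 * \<mu> * (real N + 1)" using N(2) t(2) by simp
    finally have "real K < real N + 1" using \<mu> by simp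
    then show ?thesis by simp
  qed
  define A where "A = {x \<in> I. typeC b h C x}"
  define d where "d = typeC_density b h C I"
  have card_A: "real (card A) = d * z ^ 6" and d: "d \<ge> 0"
    using \<open>L > 0\<close> L scale_powers(2)[of n] by (simp_all add: d_def typeC_density_def A_def I z_def)
  have N_mean: "real (3 * N) * \<mu> \<le> real a" using N(1) t(1) by (simp add: mult_ac)
  have "d * z ^ 6 * (1 - 1 / z\<^sup>2) \<le> real (card A) * (1 - real (3 * N) * \<sigma>\<^sup>2 / t\<^sup>2)"
    unfolding card_A t_def z_def using z d
    by (intro mult_left_mono diff_left_mono chebyshev_margin[OF ctx N_mean]) (auto simp: z_def)
  also have "\<dots> \<le> (\<Sum>k<K. wmean b (3 * N) (\<lambda>xs. of_bool (1 + k + sum_list (map h xs) \<in> A)))"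
  proof (rule wmean_covering)
    show "A \<subseteq> {a..<a + L}" by (auto simp: A_def I)
    show "real 1 + real (3 * N) * \<mu> + t \<le> real a" using N(1) by (simp add: algebra_simps)
    show "real a + real L \<le> real 1 + real (3 * N) * \<mu> - t + real K"
      using N(2) K(1) L by (simp add: z_def algebra_simps)
  qed (use b_gt_1 t in auto)
  finally obtain k where k: "k < K"
    "d * z ^ 6 * (1 - 1 / z\<^sup>2) / real K \<le> wmean b (3 * N) (\<lambda>xs. of_bool (1 + k + sum_list (map h xs) \<in> A))"
    by (rule exists_ge_average[OF K0])
  obtain p where p: "b ^ (N - 1) \<le> p" "p < b ^ N" "happyH b h p = 1 + k"
    using exists_prefix[of b h "1 + k" N] b_gt_1 h0 h1 k(1) KN by auto
  let ?I' = "{p * b ^ (3 * N)..<p * b ^ (3 * N) + b ^ (3 * N)}"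
  have "real n / 2 \<le> real N"
    using scale_power6_ge[of n] K(1) KN t \<mu> by (simp add: z_def)
  then have n': "2 * n \<le> 4 * N" by linarith
  define c where "c = \<sigma> / sqrt \<mu>"
  \<comment> \<open>Averaging over \<open>K\<close> rather than \<open>z ^ 6\<close> shifts costs
    the factor \<open>z ^ 6 / K\<close>, here bounded below by an exponential.\<close>
  have "real K \<le> z ^ 6 + 4 * c * z ^ 5"
    using K(2) t(3) rounding_le[OF ctx] by (simp add: c_def z_def)
  also have "\<dots> = z ^ 6 * (1 + 4 * c / z)"
    using z by (simp add: distrib_left) (simp add: eval_nat_numeral)
  also have "\<dots> \<le> z ^ 6 * exp (4 * c / z)"
    using z exp_ge_add_one_self[of "4 * c / z"] by (intro mult_left_mono) auto
  finally have "exp (- (4 * c / z)) \<le> z ^ 6 / real K"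
    using K0 by (simp add: exp_minus field_simps)
  moreover have z2': "1 / z\<^sup>2 \<le> 1 / 2" using z2 by (intro divide_left_mono) auto
  then have "exp (- 2 / z\<^sup>2) \<le> 1 - 1 / z\<^sup>2"
    using exp_minus_double_le[of "1 / z\<^sup>2"] by simp
  ultimately have "exp (- 2 / z\<^sup>2) * exp (- (4 * c / z)) \<le> (1 - 1 / z\<^sup>2) * (z ^ 6 / real K)"
    using z2' by (intro mult_mono) (auto simp del: divide_le_eq_1_pos)
  then have "d * exp (- 2 / z\<^sup>2 - 4 * c / z) \<le> d * ((1 - 1 / z\<^sup>2) * (z ^ 6 / real K))"
    using d by (intro mult_left_mono) (simp_all flip: exp_add)
  also have "\<dots> = d * z ^ 6 * (1 - 1 / z\<^sup>2) / real K" by simp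
  also note k(2)
  also have "wmean b (3 * N) (\<lambda>xs. of_bool (1 + k + sum_list (map h xs) \<in> A)) \<le> typeC_density b h C ?I'"
    using p(3) by (intro typeC_density_prefix_ge) (auto simp: A_def)
  finally have "d * exp (- 2 / z\<^sup>2 - 4 * c / z) \<le> typeC_density b h C ?I'" .
  moreover have "4 * c / z = 4 * \<sigma> / (sqrt \<mu> * z)" by (simp add: c_def)
  ultimately show ?thesis
    using that[OF n' strict_interval_prefix[OF p(1,2)]] KN K0 by (simp add: d_def z_def)
qed

definition loss :: "nat \<Rightarrow> real" where
  "loss n = 2 / ((scale n)\<^sup>2 - 1) + 4 * \<sigma> / (sqrt \<mu> * (scale n - 1))"

lemma loss_nonneg: "n > 0 \<Longrightarrow> loss n \<ge> 0"
  using scale_powers(1)[of n] one_less_power[of "scale n" 2] sd_pos mean_pos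
  by (simp add: loss_def)

text \<open>As \<open>n'\<close> is at least \<open>2 * n\<close>, the scale is at least squared,
  and \<open>1 / (z\<^sup>2 - z) = 1 / (z - 1) - 1 / z\<close> telescopes. This is used for the
  scale and for its square.\<close>

lemma loss_step:
  assumes "n > 0" "2 * n \<le> n'"
  shows "loss n' + (2 / (scale n)\<^sup>2 + 4 * \<sigma> / (sqrt \<mu> * scale n)) \<le> loss n"
proof -
  have key: "1 / (w - 1) + 1 / z \<le> 1 / (z - 1)" if "z > 1" "z\<^sup>2 \<le> w" for z w :: real
  proof -
    have "z < z\<^sup>2" using that by (simp add: power2_eq_square)
    then have "1 / (w - 1) \<le> 1 / (z\<^sup>2 - z)" using that by (intro divide_left_mono mult_pos_pos) auto
    also have "\<dots> = 1 / (z - 1) - 1 / z"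
      using that by (simp add: field_simps power2_eq_square)
    finally show ?thesis by simp
  qed
  have z: "scale n > 1" using assms(1) scale_powers(1) by simp
  have sq: "(scale n)\<^sup>2 \<le> scale n'"
    unfolding scale_powers(6)[symmetric] using assms(2) b_gt_1 by (simp add: scale_def)
  have "2 * (1 / ((scale n')\<^sup>2 - 1) + 1 / (scale n)\<^sup>2) \<le> 2 * (1 / ((scale n)\<^sup>2 - 1))"
    using z sq power_mono[OF sq, of 2] by (intro mult_left_mono key) (auto intro: one_less_power)
  moreover have "4 * \<sigma> / sqrt \<mu> * (1 / (scale n' - 1) + 1 / scale n) \<le> 4 * \<sigma> / sqrt \<mu> * (1 / (scale n - 1))"
    using z sq sd_pos mean_pos by (intro mult_left_mono key) auto
  ultimately show ?thesis by (simp add: loss_def distrib_left)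
qed

lemma strict_intervals_unbounded:
  assumes "bounded_scale n" "strict_interval b n I"
  shows "\<exists>n' I'. N \<le> n' \<and> bounded_scale n' \<and> strict_interval b n' I' \<and>
    typeC_density b h C I * exp (- loss n) \<le> typeC_density b h C I'"
proof -
  have nonneg: "typeC_density b h C J \<ge> 0" for J by (simp add: typeC_density_def)
  \<comment> \<open>The invariant keeps \<open>loss n'\<close> in reserve for the steps still to
    come; it is dropped only at the end.\<close>
  have "\<exists>n' I'. N \<le> n' \<and> bounded_scale n' \<and> strict_interval b n' I' \<and>
      typeC_density b h C I * exp (- loss n) \<le> typeC_density b h C I' * exp (- loss n')"
  proof (induction N)
    case 0
    then show ?case using assms by blast
  next
    case (Suc N)
    then obtain m J where J: "N \<le> m" "bounded_scale m" "strict_interval b m J"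
      "typeC_density b h C I * exp (- loss n) \<le> typeC_density b h C J * exp (- loss m)" by blast
    obtain m' J' where J': "2 * m \<le> m'" "strict_interval b m' J'"
      "typeC_density b h C J * exp (- 2 / (scale m)\<^sup>2 - 4 * \<sigma> / (sqrt \<mu> * scale m)) \<le> typeC_density b h C J'"
      using strict_step[OF J(2,3)] by blast
    have m: "m > 0" using J(2) by (simp add: bounded_scale_def)
    note J(4)
    also have "typeC_density b h C J * exp (- loss m) \<le> typeC_density b h C J *
        (exp (- 2 / (scale m)\<^sup>2 - 4 * \<sigma> / (sqrt \<mu> * scale m)) * exp (- loss m'))"
      using loss_step[OF m J'(1)] by (intro mult_left_mono nonneg) (simp flip: exp_add)
    also have "\<dots> \<le> typeC_density b h C J' * exp (- loss m')"
      using J'(3) by (simp add: mult_right_mono flip: mult.assoc)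
    finally show ?case
      using J(1) J'(1,2) m bounded_scale_mono[OF J(2), of m'] by (intro exI[of _ m'] exI[of _ J']) auto
  qed
  then obtain n' I' where *: "N \<le> n'" "bounded_scale n'" "strict_interval b n' I'"
    "typeC_density b h C I * exp (- loss n) \<le> typeC_density b h C I' * exp (- loss n')" by blast
  have "typeC_density b h C I' * exp (- loss n') \<le> typeC_density b h C I'"
    using loss_nonneg[of n'] *(2) by (intro mult_left_le nonneg) (simp add: bounded_scale_def)
  with * show ?thesis by (intro exI[of _ n'] exI[of _ I']) auto
qed

end

section \<open>From strict intervals to the upper density\<close>

context happy_function
begin

text \<open>The mean digit sum of \<open>b\<close> digits is the integer \<open>q\<close>, so
  \<open>b * t\<close> further digits produce the shift \<open>q * t\<close> on average. Replacing a
  shift \<open>q * t + u\<close> by this random one moves it by at most \<open>q\<close> plus a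
  standard deviation, and \<open>wmean_shift\<close> prices that move.\<close>

lemma wmean_smoothing:
  assumes "m > 0" "R > 0"
  defines "q \<equiv> \<Sum>j<b. h j"
  obtains t where "t < R"
    "(\<Sum>k<q * R. wmean b m (\<lambda>xs. of_bool (k + sum_list (map h xs) \<in> A))) / real (q * R)
        - 2 * sqrt (real b / real m) * (real q + \<sigma> * sqrt (real b * real R))
      \<le> wmean b (b * t + m) (\<lambda>xs. of_bool (sum_list (map h xs) \<in> A))"
proof -
  let ?S = "\<lambda>xs. sum_list (map h xs)"
  define g where "g = (\<lambda>k. wmean b m (\<lambda>xs. of_bool (k + ?S xs \<in> A)))"
  define W where "W = (\<lambda>t. wmean b (b * t + m) (\<lambda>xs. of_bool (?S xs \<in> A)))"
  define e where "e = 2 * sqrt (real b / real m)"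
  define \<rho> where "\<rho> = \<sigma> * sqrt (real b * real R)"
  have b: "b > 0" using b_gt_1 by simp
  have q: "real q = real b * \<mu>" using b_mean by (simp add: q_def)
  then have q_pos: "real q > 0" using b_mean_ge_1 by simp
  have e: "e \<ge> 0" by (simp add: e_def)
  have lip: "\<bar>g y - g z\<bar> \<le> e * \<bar>real y - real z\<bar>" for y z
    unfolding g_def e_def
    using wmean_shift[of b h m "\<lambda>s. of_bool (s \<in> A)" y z] b_gt_1 h0 h1 assms(1) by simp
  \<comment> \<open>Condition on the \<open>b * t\<close> extra digits: their sum has mean
    \<open>q * t\<close> and mean absolute deviation at most \<open>\<rho>\<close>, and
    \<open>g\<close> is Lipschitz with constant \<open>e\<close>.\<close>
  have W: "g (q * t) - e * \<rho> \<le> W t" if "t < R" for t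
  proof -
    have "wmean b (b * t) (\<lambda>xs. (real (?S xs) - real (q * t))\<^sup>2) = real (b * t) * \<sigma>\<^sup>2"
      using wmean_digit_variance[OF b, of "b * t" h] by (simp add: q mult_ac)
    also have "\<dots> \<le> (real b * real R) * \<sigma>\<^sup>2" using that by (intro mult_right_mono) (auto intro: mult_left_mono)
    finally have "sqrt (wmean b (b * t) (\<lambda>xs. (real (?S xs) - real (q * t))\<^sup>2)) \<le> sqrt ((real b * real R) * \<sigma>\<^sup>2)"
      by (rule real_sqrt_le_mono)
    also have "\<dots> = \<rho>" using sd_pos by (simp add: \<rho>_def real_sqrt_mult)
    finally have dev: "wmean b (b * t) (\<lambda>xs. \<bar>real (?S xs) - real (q * t)\<bar>) \<le> \<rho>"
      using wmean_abs_le_sqrt[OF b] by (rule order_trans[rotated])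
    have "g (q * t) - e * \<rho> \<le> g (q * t) - e * wmean b (b * t) (\<lambda>xs. \<bar>real (?S xs) - real (q * t)\<bar>)"
      using dev e by (intro diff_left_mono mult_left_mono)
    also have "\<dots> = wmean b (b * t) (\<lambda>xs. g (q * t) - e * \<bar>real (?S xs) - real (q * t)\<bar>)"
      by (simp only: wmean_diff wmean_cmult wmean_const[OF b])
    also have "\<dots> \<le> wmean b (b * t) (\<lambda>xs. g (?S xs))"
    proof (rule wmean_mono)
      show "g (q * t) - e * \<bar>real (?S xs) - real (q * t)\<bar> \<le> g (?S xs)" for xs
        using lip[of "?S xs" "q * t"] by linarith
    qed
    also have "\<dots> = W t" by (simp add: W_def g_def wmean_append)
    finally show ?thesis .
  qed
  have "(\<Sum>k<q * R. g k) = (\<Sum>u<q. \<Sum>t<R. g (q * t + u))" by (rule sum_lessThan_mult)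
  also have "\<dots> \<le> (\<Sum>u<q. \<Sum>t<R. W t + e * (real q + \<rho>))"
  proof (intro sum_mono)
    fix u t assume "u \<in> {..<q}" "t \<in> {..<R}"
    then have "e * \<bar>real (q * t + u) - real (q * t)\<bar> \<le> e * real q"
      using e by (intro mult_left_mono) auto
    then have "g (q * t + u) \<le> g (q * t) + e * real q"
      using lip[of "q * t + u" "q * t"] by linarith
    then show "g (q * t + u) \<le> W t + e * (real q + \<rho>)"
      using W[of t] \<open>t \<in> {..<R}\<close> by (simp add: distrib_left)
  qed
  also have "\<dots> = real q * ((\<Sum>t<R. W t) + real R * (e * (real q + \<rho>)))"
    by (simp add: sum.distrib)
  finally have "(\<Sum>k<q * R. g k) / real q - real R * (e * (real q + \<rho>)) \<le> (\<Sum>t<R. W t)"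
    using q_pos by (simp add: field_simps)
  then obtain t where "t < R"
    and t: "((\<Sum>k<q * R. g k) / real q - real R * (e * (real q + \<rho>))) / real R \<le> W t"
    using exists_ge_average[OF assms(2)] by blast
  have "((\<Sum>k<q * R. g k) / real q - real R * (e * (real q + \<rho>))) / real R
      = (\<Sum>k<q * R. g k) / real (q * R) - e * (real q + \<rho>)"
    using assms(2) by (simp add: diff_divide_distrib)
  with t \<open>t < R\<close> show ?thesis
    by (intro that[of t]) (simp_all add: W_def g_def e_def \<rho>_def)
qed

text \<open>The constant \<open>F\<close> depends on neither \<open>n\<close> nor \<open>I\<close>,
  so the error vanishes along the chain of intervals, while the first conjunct drives
  \<open>M\<close> to infinity.\<close>

lemma typeC_density_power_ge:
  obtains F where "\<And>n I. bounded_scale n \<Longrightarrow> strict_interval b n I \<Longrightarrow>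
    \<exists>M. real n \<le> 2 * real b * \<mu> * real M \<and>
      typeC_density b h C I - F / scale n \<le> typeC_density b h C {0..<b ^ M}"
proof -
  define q where "q = (\<Sum>j<b. h j)"
  define E where "E = 2 * (\<sigma> / sqrt \<mu>) + \<mu> + real q"
  define G where "G = real q + \<sigma> * sqrt (real b * (1 + E))"
  define F where "F = 1 + E + 2 * (real b * sqrt (2 * \<mu>)) * G"
  have \<mu>: "\<mu> > 0" by (rule mean_pos)
  have q: "real q = real b * \<mu>" using b_mean by (simp add: q_def)
  then have q1: "real q \<ge> 1" using b_mean_ge_1 by simp
  have b: "real b > 0" using b_gt_1 by simp
  have E: "E \<ge> 0" using \<mu> sd_pos by (simp add: E_def)
  have G: "G \<ge> 0" using E sd_pos by (simp add: G_def)
  have "\<exists>M. real n \<le> 2 * real b * \<mu> * real M \<and>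
      typeC_density b h C I - F / scale n \<le> typeC_density b h C {0..<b ^ M}"
    if B: "bounded_scale n" and SI: "strict_interval b n I" for n I
  proof -
    obtain a L where I: "I = {a..<a + L}" and "L > 0" and a: "b ^ (n - 1) \<le> a" "a + L \<le> b ^ n"
      and "real L = real b powr (3 * real n / 4)"
      using strict_interval_obtain[OF SI b_gt_1] by metis
    then have L: "real L = scale n ^ 6" by (simp add: scale_powers)
    have a_le: "a \<le> b ^ n" using a(2) by simp
    note ctx = B a(1) a_le
    define t z where "t = margin n a" and "z = scale n"
    have z: "z \<ge> 1" using B scale_powers(1)[of n] by (simp add: z_def bounded_scale_def)
    have t: "t > 0" "t \<le> real a / 4 - 1" "t \<le> \<sigma> / sqrt \<mu> * z ^ 5"
      using margin_pos[OF ctx] margin_le_quarter[OF ctx] margin_le[OF ctx] by (simp_all add: t_def z_def)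
    have "0 \<le> sqrt 2 * \<sigma> * scale n ^ 5" using sd_pos scale_powers(2)[of n] by simp
    then have "12 * \<mu> \<le> real b ^ (n - 1)" using B by (simp add: bounded_scale_def)
    then have a12: "12 * \<mu> \<le> real a" using real_a_ge[OF ctx] by linarith
    have a_z: "z ^ 8 \<le> real b * real a"
      unfolding z_def b_times_power[OF ctx, symmetric] using real_a_ge[OF ctx] by (intro mult_left_mono) auto
    \<comment> \<open>There is no prefix now, so \<open>m\<close> digits may have mean up to
      \<open>a - t\<close>. The range \<open>q * R\<close> covers the interval, both deviations and
      the rounding of \<open>m\<close>.\<close>
    define m where "m = nat \<lfloor>(real a - t) / \<mu>\<rfloor>"
    define R where "R = nat \<lceil>(z ^ 6 + 2 * t + \<mu>) / real q\<rceil>"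
    have "0 \<le> (real a - t) / \<mu>" using t \<mu> by simp
    then have "real m \<le> (real a - t) / \<mu>" "(real a - t) / \<mu> < real m + 1"
      unfolding m_def by linarith+
    then have m: "real m * \<mu> \<le> real a - t" "real a - t < real m * \<mu> + \<mu>"
      using \<mu> by (simp_all add: field_simps)
    have m_ge: "z ^ 8 \<le> 2 * real b * \<mu> * real m"
    proof -
      have "real a \<le> 2 * (real m * \<mu>)" using m(2) t(2) a12 \<mu> by linarith
      then have "real b * real a \<le> real b * (2 * (real m * \<mu>))" using b by (intro mult_left_mono) auto
      then show ?thesis using a_z by (simp add: mult_ac)
    qed
    have "0 < z ^ 8" using z by simp
    then have m_pos: "m > 0" using m_ge by (cases m) auto
    have "0 < (z ^ 6 + 2 * t + \<mu>) / real q" using z t \<mu> q1 by (intro divide_pos_pos add_pos_pos) auto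
    then have "(z ^ 6 + 2 * t + \<mu>) / real q \<le> real R" "real R < (z ^ 6 + 2 * t + \<mu>) / real q + 1" "R > 0"
      unfolding R_def by linarith+
    then have K: "z ^ 6 + 2 * t + \<mu> \<le> real (q * R)" "real (q * R) \<le> z ^ 6 + 2 * t + \<mu> + real q"
      and R_pos: "R > 0"
      using q1 by (simp_all add: field_simps)
    have "z ^ 6 + 2 * t + \<mu> + real q \<le> z ^ 6 + 2 * (\<sigma> / sqrt \<mu> * z ^ 5) + (\<mu> + real q) * 1"
      using t(3) by simp
    also have "\<dots> \<le> z ^ 6 + 2 * (\<sigma> / sqrt \<mu> * z ^ 5) + (\<mu> + real q) * z ^ 5"
      using z \<mu> q1 by (intro add_left_mono mult_left_mono one_le_power) auto
    also have "\<dots> = z ^ 6 + E * z ^ 5" by (simp add: E_def distrib_right)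
    finally have K_le: "real (q * R) \<le> z ^ 6 + E * z ^ 5" using K(2) by simp
    define A where "A = {x \<in> I. typeC b h C x}"
    define d where "d = typeC_density b h C I"
    have card_A: "real (card A) = d * z ^ 6" and d: "d \<ge> 0"
      using \<open>L > 0\<close> L scale_powers(2)[of n] by (simp_all add: d_def typeC_density_def A_def I z_def)
    have "card A \<le> card I" by (intro card_mono) (auto simp: A_def I)
    then have "d * z ^ 6 \<le> 1 * z ^ 6" using card_A L by (simp add: I z_def)
    then have d1: "d \<le> 1" using z by (subst (asm) mult_le_cancel_right) auto
    have "d * z ^ 6 * (1 - 1 / z\<^sup>2) \<le> real (card A) * (1 - real m * \<sigma>\<^sup>2 / t\<^sup>2)"
      unfolding card_A t_def z_def using m(1) t z d
      by (intro mult_left_mono diff_left_mono chebyshev_margin[OF ctx]) (auto simp: z_def)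
    also have "\<dots> \<le> (\<Sum>k<q * R. wmean b m (\<lambda>xs. of_bool (0 + k + sum_list (map h xs) \<in> A)))"
    proof (rule wmean_covering)
      show "A \<subseteq> {a..<a + L}" by (auto simp: A_def I)
      show "real 0 + real m * \<mu> + t \<le> real a" using m(1) by simp
      show "real a + real L \<le> real 0 + real m * \<mu> - t + real (q * R)"
        using m(2) K(1) L by (simp add: z_def)
    qed (use b_gt_1 t in auto)
    finally have sum_ge: "d * z ^ 6 * (1 - 1 / z\<^sup>2) \<le>
        (\<Sum>k<q * R. wmean b m (\<lambda>xs. of_bool (k + sum_list (map h xs) \<in> A)))" by simp
    obtain s where s: "(\<Sum>k<q * R. wmean b m (\<lambda>xs. of_bool (k + sum_list (map h xs) \<in> A))) / real (q * R)
        - 2 * sqrt (real b / real m) * (real q + \<sigma> * sqrt (real b * real R))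
      \<le> wmean b (b * s + m) (\<lambda>xs. of_bool (sum_list (map h xs) \<in> A))"
      using wmean_smoothing[OF m_pos R_pos, of A] unfolding q_def[symmetric] by blast
    \<comment> \<open>The relative losses from Chebyshev and from \<open>q * R\<close> exceeding
      \<open>z ^ 6\<close> become additive because \<open>d \<le> 1\<close>.\<close>
    have main: "d - (1 + E) / z \<le> d * z ^ 6 * (1 - 1 / z\<^sup>2) / real (q * R)"
    proof -
      have zz: "z ^ 6 = z * z ^ 5" by (simp add: eval_nat_numeral)
      have "1 / z\<^sup>2 \<le> 1 / z" using z by (simp add: power2_eq_square field_simps)
      then have "1 - 1 / z - E / z \<le> (1 - 1 / z\<^sup>2) / (1 + E / z)"
      proof -
        have "(1 - 1 / z - E / z) * (1 + E / z) = 1 - 1 / z - (1 / z) * (E / z) - (E / z)\<^sup>2"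
          by (simp add: algebra_simps power2_eq_square)
        also have "\<dots> \<le> 1 - 1 / z\<^sup>2"
          using \<open>1 / z\<^sup>2 \<le> 1 / z\<close> z E by (smt (verit) divide_nonneg_nonneg mult_nonneg_nonneg zero_le_power2)
        finally show ?thesis using z E by (simp add: pos_le_divide_eq add_pos_nonneg)
      qed
      also have "\<dots> = (1 - 1 / z\<^sup>2) * (z ^ 6 / (z ^ 6 + E * z ^ 5))"
      proof -
        have "z ^ 6 + E * z ^ 5 = z ^ 6 * (1 + E / z)" using z by (simp add: zz field_simps)
        then show ?thesis using z by simp
      qed
      also have "\<dots> \<le> (1 - 1 / z\<^sup>2) * (z ^ 6 / real (q * R))"
        using z K_le q1 R_pos one_le_power[OF z, of 2]
        by (intro mult_left_mono divide_left_mono) (auto intro!: mult_pos_pos add_pos_nonneg simp: E)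
      finally have "d * (1 - 1 / z - E / z) \<le> d * ((1 - 1 / z\<^sup>2) * (z ^ 6 / real (q * R)))"
        using d by (intro mult_left_mono)
      moreover have "d * ((1 + E) / z) \<le> 1 * ((1 + E) / z)"
        using d1 z E by (intro mult_right_mono) auto
      ultimately show ?thesis by (simp add: algebra_simps add_divide_distrib)
    qed
    \<comment> \<open>Since \<open>m\<close> is at least of order \<open>z ^ 8\<close>, a unit shift
      costs O(\<open>1 / z ^ 4\<close>); since \<open>R\<close> is at most of order
      \<open>z ^ 6\<close>, the random shift fluctuates by O(\<open>z ^ 3\<close>). The product is
      O(\<open>1 / z\<close>).\<close>
    have err: "2 * sqrt (real b / real m) * (real q + \<sigma> * sqrt (real b * real R)) \<le>
        2 * (real b * sqrt (2 * \<mu>)) * G / z"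
    proof -
      have z4: "sqrt (z ^ 8) = z ^ 4" using z
        by (intro real_sqrt_unique) (auto simp flip: power_mult)
      have "real b / real m \<le> real b * (2 * real b * \<mu>) / z ^ 8"
        using m_ge m_pos b \<open>0 < z ^ 8\<close> by (simp add: field_simps)
      then have "sqrt (real b / real m) \<le> sqrt ((real b)\<^sup>2 * (2 * \<mu>) / z ^ 8)"
        by (intro real_sqrt_le_mono) (simp add: power2_eq_square mult_ac)
      also have "\<dots> = real b * sqrt (2 * \<mu>) / z ^ 4"
        by (simp only: real_sqrt_divide real_sqrt_mult z4 real_sqrt_abs abs_of_nat)
      finally have 1: "sqrt (real b / real m) \<le> real b * sqrt (2 * \<mu>) / z ^ 4" .
      have "real R * 1 \<le> real R * real q" using q1 by (intro mult_left_mono) auto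
      also have "\<dots> \<le> z ^ 6 + E * z ^ 5" using K_le by (simp add: mult.commute)
      also have "\<dots> \<le> z ^ 6 + E * z ^ 6"
        using z E by (intro add_left_mono mult_left_mono power_increasing) auto
      finally have "real b * real R \<le> real b * ((1 + E) * z ^ 6)"
        using b by (intro mult_left_mono) (simp_all add: distrib_right)
      then have "sqrt (real b * real R) \<le> sqrt (real b * (1 + E) * (z ^ 3)\<^sup>2)"
        by (intro real_sqrt_le_mono) (simp add: mult.assoc flip: power_mult)
      also have "\<dots> = sqrt (real b * (1 + E)) * z ^ 3"
        using z by (simp only: real_sqrt_mult[of _ "(z ^ 3)\<^sup>2"] real_sqrt_abs) simp
      finally have "\<sigma> * sqrt (real b * real R) \<le> \<sigma> * (sqrt (real b * (1 + E)) * z ^ 3)"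
        using sd_pos by (intro mult_left_mono) auto
      moreover have "real q * 1 \<le> real q * z ^ 3" using z by (intro mult_left_mono one_le_power) auto
      ultimately have 2: "real q + \<sigma> * sqrt (real b * real R) \<le> G * z ^ 3"
        by (simp add: G_def algebra_simps)
      have "2 * sqrt (real b / real m) * (real q + \<sigma> * sqrt (real b * real R)) \<le>
          2 * (real b * sqrt (2 * \<mu>) / z ^ 4) * (G * z ^ 3)"
        using 1 2 sd_pos \<mu> z by (intro mult_mono) auto
      also have "\<dots> = 2 * (real b * sqrt (2 * \<mu>)) * G / z"
        using z by (simp add: eval_nat_numeral)
      finally show ?thesis .
    qed
    have "d - F / z = d - (1 + E) / z - 2 * (real b * sqrt (2 * \<mu>)) * G / z"
      by (simp add: F_def add_divide_distrib)
    also have "\<dots> \<le> d * z ^ 6 * (1 - 1 / z\<^sup>2) / real (q * R)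
        - 2 * sqrt (real b / real m) * (real q + \<sigma> * sqrt (real b * real R))"
      using main err by simp
    also have "\<dots> \<le> (\<Sum>k<q * R. wmean b m (\<lambda>xs. of_bool (k + sum_list (map h xs) \<in> A))) / real (q * R)
        - 2 * sqrt (real b / real m) * (real q + \<sigma> * sqrt (real b * real R))"
      using sum_ge by (intro diff_right_mono divide_right_mono) auto
    also note s
    also have "wmean b (b * s + m) (\<lambda>xs. of_bool (sum_list (map h xs) \<in> A)) \<le> typeC_density b h C {0..<b ^ (b * s + m)}"
      using typeC_density_prefix_ge[of 0 0 A C "b * s + m"] by (simp add: A_def happyH_0)
    finally have dens: "d - F / z \<le> typeC_density b h C {0..<b ^ (b * s + m)}" .
    have "real n \<le> 2 ^ n" using of_nat_less_two_power[of n] by (rule less_imp_le)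
    also have "(2::real) ^ n \<le> z ^ 8"
      unfolding z_def scale_powers(3) using b_gt_1 by (intro power_mono) auto
    also note m_ge
    also have "2 * real b * \<mu> * real m \<le> 2 * real b * \<mu> * real (b * s + m)"
      using \<mu> by (intro mult_left_mono) auto
    finally show ?thesis using dens unfolding d_def z_def by blast
  qed
  then show ?thesis by (rule that)
qed

lemma limsup_density_ge:
  assumes "bounded_scale n" "strict_interval b n I"
  shows "ereal (typeC_density b h C I * exp (- loss n)) \<le>
    limsup (\<lambda>N. ereal (real (card {i\<in>{1..N}. typeC b h C i}) / real N))"
proof (rule ccontr)
  let ?u = "\<lambda>N. real (card {i\<in>{1..N}. typeC b h C i}) / real N"
  define D where "D = typeC_density b h C I * exp (- loss n)"
  assume "\<not> ?thesis"
  then have "limsup (\<lambda>N. ereal (?u N)) < ereal D" by (simp add: D_def)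
  then obtain y where y: "limsup (\<lambda>N. ereal (?u N)) < ereal y" "y < D"
    using ereal_dense2[of "limsup (\<lambda>N. ereal (?u N))" "ereal D"] by auto
  from Limsup_lessD[OF y(1)] obtain N0 where N0: "\<And>N. N \<ge> N0 \<Longrightarrow> ?u N < y"
    by (auto simp: eventually_sequentially)
  obtain F where F: "\<And>n I. bounded_scale n \<Longrightarrow> strict_interval b n I \<Longrightarrow>
    \<exists>M. real n \<le> 2 * real b * \<mu> * real M \<and>
      typeC_density b h C I - F / scale n \<le> typeC_density b h C {0..<b ^ M}"
    using typeC_density_power_ge[of C] by blast
  \<comment> \<open>Two errors share the gap \<open>D - y\<close>: the transfer error
    \<open>F / scale n'\<close> and the error from counting 0.\<close>
  define \<epsilon> where "\<epsilon> = (D - y) / 2"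
  have \<epsilon>: "\<epsilon> > 0" using y by (simp add: \<epsilon>_def)
  have "(\<lambda>k. F / scale 1 ^ k) \<longlonglongrightarrow> 0"
    using scale_powers(1)[of 1] by (intro LIMSEQ_divide_realpow_zero) simp
  then have "eventually (\<lambda>k. F / scale 1 ^ k < \<epsilon>) sequentially"
    using \<epsilon> by (rule order_tendstoD)
  then obtain k1 where k1: "\<And>k. k \<ge> k1 \<Longrightarrow> F / scale 1 ^ k < \<epsilon>"
    by (auto simp: eventually_sequentially)
  obtain k2 :: nat where k2: "real k2 > 2 * real b * \<mu> * (real N0 + 1 / \<epsilon>)"
    using reals_Archimedean2 by blast
  obtain n' I' where n': "max k1 k2 \<le> n'" "bounded_scale n'" "strict_interval b n' I'"
    "D \<le> typeC_density b h C I'"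
    using strict_intervals_unbounded[OF assms] unfolding D_def by metis
  obtain M where M: "real n' \<le> 2 * real b * \<mu> * real M"
    "typeC_density b h C I' - F / scale n' \<le> typeC_density b h C {0..<b ^ M}"
    using F[OF n'(2,3)] by blast
  have "scale n' = scale 1 ^ n'" using b_gt_1 by (simp add: scale_def powr_power)
  then have Fn: "F / scale n' < \<epsilon>" using k1[of n'] n'(1) by simp
  have "2 * real b * \<mu> * (real N0 + 1 / \<epsilon>) < 2 * real b * \<mu> * real M"
    using M(1) k2 n'(1) by simp
  then have M_big: "real N0 + 1 / \<epsilon> < real M"
    using mean_pos b_gt_1 by (subst (asm) mult_less_cancel_left_pos) auto
  have "M < 2 ^ M" by simp
  also have "2 ^ M \<le> b ^ M" using b_gt_1 by (intro power_mono) auto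
  finally have "M < b ^ M" .
  then have bM: "real N0 + 1 / \<epsilon> < real (b ^ M)" using M_big by linarith
  \<comment> \<open>The number 0 lies in the first range but not in the second; this costs at most 1
    in the count.\<close>
  have "card {x \<in> {0..<b ^ M}. typeC b h C x} \<le> card (insert 0 {i \<in> {1..b ^ M}. typeC b h C i})"
    by (intro card_mono) auto
  also have "\<dots> = card {i \<in> {1..b ^ M}. typeC b h C i} + 1" by simp
  finally have "real (card {x \<in> {0..<b ^ M}. typeC b h C x}) / real (b ^ M) \<le>
      (real (card {i \<in> {1..b ^ M}. typeC b h C i}) + 1) / real (b ^ M)"
    by (intro divide_right_mono) auto
  then have "typeC_density b h C {0..<b ^ M} \<le> ?u (b ^ M) + 1 / real (b ^ M)"
    by (simp add: typeC_density_def add_divide_distrib)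
  moreover have "1 / real (b ^ M) < \<epsilon>"
  proof -
    have "1 / \<epsilon> < real (b ^ M)" using bM by linarith
    moreover have "0 < real (b ^ M)" using b_gt_1 by simp
    ultimately show ?thesis using \<epsilon> by (simp only: divide_less_eq if_True mult.commute)
  qed
  moreover have "N0 \<le> b ^ M"
  proof -
    have "real N0 < real (b ^ M)" using bM \<epsilon> by (smt (verit) divide_pos_pos)
    then show ?thesis by linarith
  qed
  then have "?u (b ^ M) < y" by (rule N0)
  moreover have "D = y + 2 * \<epsilon>" by (simp add: \<epsilon>_def field_simps)
  ultimately show False using M(2) n'(4) Fn by linarith
qed

end

theorem theorem4p1:
  fixes b n1 :: nat and h :: "nat \<Rightarrow> nat" and C I1 :: "nat set" and d1 :: real
  assumes hb: "b > 1"
    and h0: "h 0 = 0" and h1: "h 1 = 1"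
    and hn1: "n1 > 0"
    and B1: "4 * (1 + 3 * digit_mean b h + sqrt 2 * digit_sd b h * real b powr (5 * real n1 / 8))
               \<le> real b ^ (n1 - 1)"
    and B2: "sqrt (3 * digit_mean b h * real b) * digit_sd b h \<le> real b powr (3 * real n1 / 8)"
    and B3: "4 * digit_mean b h * (3 * digit_mean b h + 1 + real b powr (3 * real n1 / 4)
               + 2 * digit_sd b h / sqrt (digit_mean b h) * real b powr (5 * real n1 / 8))
               \<le> real b ^ (n1 - 1)"
    and hI: "strict_interval b n1 I1"
    and hd: "typeC_density b h C I1 = d1"
  shows "limsup (\<lambda>N. ereal (real (card {i\<in>{1..N}. typeC b h C i}) / real N))
         \<ge> ereal (d1 * exp (- 2 / (real b powr (real n1 / 4) - 1)
              - 4 * digit_sd b h / (sqrt (digit_mean b h) * (real b powr (real n1 / 8) - 1))))"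
proof -
  interpret happy_function b h
    using hb h0 h1 by unfold_locales
  have "bounded_scale n1"
    using hn1 B1 B3 by (simp add: bounded_scale_def scale_powers)
  from limsup_density_ge[OF this hI, of C] show ?thesis
    by (simp add: hd loss_def scale_powers(6) scale_def)
qed

end
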